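(* Let $X$ be an order continuous Banach lattice. Then $X$ is BWCG (weakly compactly generated as a band) if and only if $X$ is WCG (weakly compactly generated as a Banach space).
   Context: Subspaces and bands are assumed to be (norm) closed. An ideal of a Banach lattice $X$ is a subspace $Y$ such that $|x|\le |y|$ with $y\in Y$ implies $x\in Y$. A band of $X$ is an ideal $Z$ such that $\sup(A)\in Z$ whenever $A\subset Z$ and $\sup(A)$ exists in $X$. For $A\subset X$, $\overline{\mathrm{span}}(A)$ is the closed linear span of $A$ and $B(A)$ is the smallest band of $X$ containing $A$. $X$ is BWCG if there is a weakly compact set $K\subset X$ with $X=B(K)$. $X$ is WCG if there is a weakly compact set $K\subset X$ with $X=\overline{\mathrm{span}}(K)$. *)

theory Defs
  imports "HOL-Analysis.Analysis" "HOL-Library.Lattice_Algebras" "HOL-Library.Lub_Glb"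
begin

class banach_lattice = banach + ordered_real_vector + lattice_ab_group_add_abs +
  assumes norm_mono: "\<bar>x\<bar> \<le> \<bar>y\<bar> \<Longrightarrow> norm x \<le> norm y"

instance real :: banach_lattice
  by standard simp

text \<open>The norm is order continuous if \<open>x\<^sub>\<alpha> \<down> 0\<close> implies \<open>norm x\<^sub>\<alpha> \<rightarrow> 0\<close>. A net decreasing
  to \<open>0\<close> is given here by its range, a downward directed set indexed by itself in the reverse
  order; the condition on the norms is convergence of that net.\<close>

definition downward_directed :: "'a::order set \<Rightarrow> bool" where
  "downward_directed A \<longleftrightarrow> A \<noteq> {} \<and> (\<forall>x\<in>A. \<forall>y\<in>A. \<exists>z\<in>A. z \<le> x \<and> z \<le> y)"

definition order_continuous :: "'a::banach_lattice itself \<Rightarrow> bool" where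
  "order_continuous _ \<longleftrightarrow>
     (\<forall>A::'a set. downward_directed A \<and> isGlb UNIV A 0 \<longrightarrow>
        (\<forall>e>0. \<exists>a\<in>A. \<forall>x\<in>A. x \<le> a \<longrightarrow> norm x < e))"

text \<open>Ideals and bands are norm closed by convention.\<close>

definition lattice_ideal :: "'a::banach_lattice set \<Rightarrow> bool" where
  "lattice_ideal Y \<longleftrightarrow>
     subspace Y \<and> closed Y \<and> (\<forall>x. \<forall>y\<in>Y. \<bar>x\<bar> \<le> \<bar>y\<bar> \<longrightarrow> x \<in> Y)"

definition band :: "'a::banach_lattice set \<Rightarrow> bool" where
  "band Z \<longleftrightarrow> lattice_ideal Z \<and> (\<forall>A s. A \<subseteq> Z \<and> isLub UNIV A s \<longrightarrow> s \<in> Z)"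

definition band_generated :: "'a::banach_lattice set \<Rightarrow> 'a set" where
  "band_generated A = \<Inter>{Z. band Z \<and> A \<subseteq> Z}"

lemma band_band_generated: "band (band_generated A)"
  unfolding band_generated_def band_def lattice_ideal_def
  by (intro conjI; (rule subspace_Inter closed_Inter)?; blast)

lemma subset_band_generated: "A \<subseteq> band_generated A"
  unfolding band_generated_def by blast

lemma band_generated_least: "band Z \<Longrightarrow> A \<subseteq> Z \<Longrightarrow> band_generated A \<subseteq> Z"
  unfolding band_generated_def by blast

text \<open>The topology \<open>\<sigma>(X, X\<^sup>*)\<close>: the coarsest one making all bounded linear functionals continuous.\<close>

definition weak_topology :: "'a::real_normed_vector topology" where
  "weak_topology =
     topology_generated_by {f -` U | (f :: 'a \<Rightarrow> real) U. bounded_linear f \<and> open U}"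

lemma topspace_weak_topology [simp]: "topspace weak_topology = UNIV"
proof -
  have "UNIV = (\<lambda>_. 0 :: real) -` UNIV" by simp
  then show ?thesis
    unfolding weak_topology_def topology_generated_by_topspace
    using bounded_linear_zero open_UNIV by blast
qed

definition weakly_compact :: "'a::real_normed_vector set \<Rightarrow> bool" where
  "weakly_compact K \<longleftrightarrow> compactin weak_topology K"

definition WCG :: "'a::banach itself \<Rightarrow> bool" where
  "WCG _ \<longleftrightarrow> (\<exists>K::'a set. weakly_compact K \<and> closure (span K) = UNIV)"

definition BWCG :: "'a::banach_lattice itself \<Rightarrow> bool" where
  "BWCG _ \<longleftrightarrow> (\<exists>K::'a set. weakly_compact K \<and> band_generated K = UNIV)"

end

(* If X is generated as a band by a weakly compact set K, Zorn's lemma gives a maximal family E of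
   pairwise disjoint positive elements, each below some |k| with k in K; the union L of the order
   intervals [0, e], e in E, together with 0, is then weakly compact with dense span.

   Order intervals are weakly compact: a positive functional that controls the norm on [0, e] makes
   a sum of the functions x |-> f |x - t e|, with t in a finite grid, uniformly convex there, so
   minimising a suitable series of such functions produces a point in every filter base of closed
   convex sets. Any sequence of distinct elements taken from different intervals [0, e] is weakly
   null: the bands of the e's yield an operator into l^1, which maps K to a norm compact set (Schur).
   Hence every weak neighbourhood of 0 contains all but finitely many of the intervals. Density
   follows from the maximality of E and the order continuity of the norm. *)

theory Submission
  imports Defs
begin

section \<open>Positive functionals\<close>

text \<open>\<open>E\<close> may be uncountable, so X need not have a weak unit and no single order
  interval need have dense span. What keeps the union of the intervals compact is that a bounded
  functional is small on all but finitely many of them, so that 0 acts like the point at infinity of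
  a one-point compactification. The obstacle is that an element of [0, e] lies below a member of
  \<open>K\<close> in modulus without belonging to \<open>K\<close>, and f may change sign, so the
  values of f on \<open>K\<close> say nothing about it directly. The remedy is the positive part of
  f carried by the band of that element. Disjointness bounds the sum of these functionals by a
  multiple of the norm, which is the operator into l^1; and the absolute value at k dominates f at
  the element. For the latter each e is taken below the positive or the negative part of k, so that
  the other part is annihilated. Uniform convexity is obtained for one precision at a time, because
  the functional and the grid depend on \<epsilon>; a weighted series joins the precisions.\<close>

definition sublinear :: "('a::real_vector \<Rightarrow> real) \<Rightarrow> bool" where
  "sublinear q \<longleftrightarrow> (\<forall>x y. q (x + y) \<le> q x + q y) \<and> (\<forall>r>0. \<forall>x. q (r *\<^sub>R x) = r * q x)"

lemma sublinear_add: "sublinear q \<Longrightarrow> q (x + y) \<le> q x + q y"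
  and sublinear_scaleR: "sublinear q \<Longrightarrow> r > 0 \<Longrightarrow> q (r *\<^sub>R x) = r * q x"
  unfolding sublinear_def by blast+

lemma sublinear_0 [simp]: "sublinear q \<Longrightarrow> q 0 = 0"
  using sublinear_scaleR[of q 2 0] by simp

lemma sublinear_scaleR_nonneg: "sublinear q \<Longrightarrow> r \<ge> 0 \<Longrightarrow> q (r *\<^sub>R x) = r * q x"
  by (cases "r = 0") (auto simp: sublinear_scaleR)

lemma sublinear_neg_le: "sublinear q \<Longrightarrow> - q (- x) \<le> q x"
  using sublinear_add[of q x "- x"] by simp

text \<open>The one-step Hahn-Banach modification: \<open>p y\<close> is the infimum over t \<ge> 0
  of q (y + t z) - t q z, finite because subadditivity gives the lower bound - q (- y). At - z the
  choice t = 1 gives - q z.\<close>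

lemma sublinear_below:
  assumes q: "sublinear q"
  obtains p where "sublinear p" "p \<le> q" "p (- z) \<le> - q z"
proof -
  define F where "F y t = q (y + t *\<^sub>R z) - t * q z" for y t
  define p where "p y = (INF t\<in>{0..}. F y t)" for y
  have lower: "- q (- y) \<le> F y t" if "t \<ge> 0" for y t
    using sublinear_add[OF q, of "y + t *\<^sub>R z" "- y"] sublinear_scaleR_nonneg[OF q that, of z]
    by (simp add: F_def)
  have bdd: "bdd_below (F y ` {0..})" for y
    by (rule bdd_belowI[of _ "- q (- y)"]) (use lower in auto)
  have le: "p y \<le> F y t" if "t \<ge> 0" for y t
    unfolding p_def using that by (intro cINF_lower bdd) auto
  have ge: "c \<le> p y" if "\<And>t. t \<ge> 0 \<Longrightarrow> c \<le> F y t" for c y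
    unfolding p_def using that by (intro cINF_greatest) auto
  have "sublinear p"
    unfolding sublinear_def
  proof (intro conjI allI impI)
    fix x y
    have *: "p (x + y) \<le> F x s + F y t" if "s \<ge> 0" "t \<ge> 0" for s t
    proof -
      have "p (x + y) \<le> F (x + y) (s + t)"
        using that by (intro le) simp
      also have "\<dots> \<le> F x s + F y t"
        using sublinear_add[OF q, of "x + s *\<^sub>R z" "y + t *\<^sub>R z"]
        by (simp add: F_def algebra_simps)
      finally show ?thesis .
    qed
    have "p (x + y) - F x s \<le> p y" if "s \<ge> 0" for s
      by (rule ge) (use *[OF that] in force)
    then have "p (x + y) - p y \<le> p x"
      by (intro ge) force
    then show "p (x + y) \<le> p x + p y"
      by simp
  next
    fix r :: real and x assume r: "r > 0"
    have F: "F (r *\<^sub>R x) (r * t) = r * F x t" for t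
      using sublinear_scaleR[OF q r, of "x + t *\<^sub>R z"] by (simp add: F_def algebra_simps)
    show "p (r *\<^sub>R x) = r * p x"
    proof (rule antisym)
      have "p (r *\<^sub>R x) / r \<le> p x"
      proof (rule ge)
        fix t :: real assume "t \<ge> 0"
        then show "p (r *\<^sub>R x) / r \<le> F x t"
          using le[of "r * t" "r *\<^sub>R x"] r by (simp add: F field_simps)
      qed
      then show "p (r *\<^sub>R x) \<le> r * p x"
        using r by (simp add: field_simps)
      show "r * p x \<le> p (r *\<^sub>R x)"
      proof (rule ge)
        fix t :: real assume "t \<ge> 0"
        then show "r * p x \<le> F (r *\<^sub>R x) t"
          using le[of "t / r" x] F[of "t / r"] r by simp
      qed
    qed
  qed
  moreover have "p \<le> q"
    using le[of 0] by (simp add: le_fun_def F_def)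
  moreover have "p (- z) \<le> - q z"
    using le[of 1 "- z"] q by (simp add: F_def)
  ultimately show thesis by (rule that)
qed

text \<open>Comparing q with the minorant from \<open>sublinear_below\<close> forces q (- x) \<le> -
  q x, so q is odd; an odd subadditive function is additive.\<close>

lemma linear_minimal_sublinear:
  assumes q: "sublinear q" and min: "\<And>p. sublinear p \<Longrightarrow> p \<le> q \<Longrightarrow> p = q"
  shows "linear q"
proof -
  have odd: "q (- x) = - q x" for x
  proof -
    obtain p where "sublinear p" "p \<le> q" "p (- x) \<le> - q x"
      using sublinear_below[OF q] .
    with min[of p] show ?thesis
      using sublinear_neg_le[OF q, of x] by simp
  qed
  show ?thesis
  proof (rule linearI)
    fix x y
    show "q (x + y) = q x + q y"
      using sublinear_add[OF q, of x y] sublinear_add[OF q, of "- x" "- y"] odd[of x] odd[of y] odd[of "x + y"]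
      by simp
  next
    fix r x
    show "q (r *\<^sub>R x) = r *\<^sub>R q x"
      using sublinear_scaleR_nonneg[OF q, of r x] sublinear_scaleR_nonneg[OF q, of "- r" x] odd[of "r *\<^sub>R x"]
      by (cases "r \<ge> 0") auto
  qed
qed

theorem Hahn_Banach_sublinear:
  assumes q: "sublinear q"
  obtains f where "linear f" "\<And>x. f x \<le> q x" "f z = q z"
proof -
  obtain q' where q': "sublinear q'" "q' \<le> q" "q' (- z) \<le> - q z"
    using sublinear_below[OF q] .
  \<comment> \<open>Zorn is applied below \<open>q'\<close> instead of q: the inequality
    \<open>q' (- z) \<le> - q z\<close> passes to every minorant, and for a linear one it yields f z
    = q z.\<close>
  define A where "A = {p. sublinear p \<and> p \<le> q'}"
  have "\<exists>m\<in>A. \<forall>a\<in>A. m \<ge> a \<longrightarrow> a = m"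
  proof (rule predicate_Zorn)
    show "partial_order_on A (relation_of (\<ge>) A)"
      by (auto simp: partial_order_on_def preorder_on_def refl_on_def trans_def antisym_def relation_of_def)
    fix C assume C: "C \<in> Chains (relation_of (\<ge>) A)"
    show "\<exists>u\<in>A. \<forall>a\<in>C. a \<ge> u"
    proof (cases "C = {}")
      case True
      then show ?thesis using q' by (auto simp: A_def)
    next
      case False
      have CA: "sublinear p" "p \<le> q'" if "p \<in> C" for p
        using C that by (auto simp: Chains_def relation_of_def A_def)
      have total: "p \<le> p' \<or> p' \<le> p" if "p \<in> C" "p' \<in> C" for p p'
        using C that by (auto simp: Chains_def relation_of_def)
      define u where "u x = (INF p\<in>C. p x)" for x
      have bdd: "bdd_below ((\<lambda>p. p x) ` C)" for x
      proof (rule bdd_belowI[of _ "- q' (- x)"], safe)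
        fix p assume "p \<in> C"
        then show "- q' (- x) \<le> p x"
          using sublinear_neg_le[OF CA(1), of p x] CA(2)[of p]
          by (smt (verit) le_funD)
      qed
      have le: "u x \<le> p x" if "p \<in> C" for p x
        unfolding u_def using that by (intro cINF_lower bdd) auto
      have ge: "c \<le> u x" if "\<And>p. p \<in> C \<Longrightarrow> c \<le> p x" for c x
        unfolding u_def using that False by (intro cINF_greatest) auto
      have "sublinear u"
        unfolding sublinear_def
      proof (intro conjI allI impI)
        fix x y
        have *: "u (x + y) \<le> p x + p' y" if pp': "p \<in> C" "p' \<in> C" for p p'
        proof -
          obtain r where r: "r \<in> C" "r \<le> p" "r \<le> p'"
            using total[OF pp'] pp' by blast
          then show ?thesis
            using le[OF r(1), of "x + y"] sublinear_add[OF CA(1)[OF r(1)], of x y]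
            by (smt (verit) le_funD)
        qed
        have "u (x + y) - p x \<le> u y" if "p \<in> C" for p
          by (rule ge) (use *[OF that] in force)
        then have "u (x + y) - u y \<le> u x"
          by (intro ge) force
        then show "u (x + y) \<le> u x + u y"
          by simp
      next
        fix r :: real and x assume r: "r > 0"
        show "u (r *\<^sub>R x) = r * u x"
        proof (rule antisym)
          have "u (r *\<^sub>R x) / r \<le> u x"
            by (rule ge) (use r le[of _ "r *\<^sub>R x"] sublinear_scaleR[OF CA(1) r] in \<open>simp add: field_simps\<close>)
          then show "u (r *\<^sub>R x) \<le> r * u x"
            using r by (simp add: field_simps)
          show "r * u x \<le> u (r *\<^sub>R x)"
          proof (rule ge)
            fix p assume p: "p \<in> C"
            show "r * u x \<le> p (r *\<^sub>R x)"
              using le[OF p, of x] sublinear_scaleR[OF CA(1)[OF p] r, of x] r by simp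
          qed
        qed
      qed
      moreover have "u \<le> q'"
        using False CA(2) le by (meson all_not_in_conv le_funD le_funI order_trans)
      ultimately have "u \<in> A"
        by (simp add: A_def)
      then show ?thesis
        using le by (auto simp: le_fun_def)
    qed
  qed
  then obtain m where m: "sublinear m" "m \<le> q'" "\<And>p. sublinear p \<Longrightarrow> p \<le> m \<Longrightarrow> p = m"
    unfolding A_def by (blast intro: order_trans)
  have lin: "linear m"
    using linear_minimal_sublinear m by blast
  have le: "m x \<le> q x" for x
    using m(2) q'(2) by (meson le_funD order_trans)
  have "m (- z) \<le> - q z"
    using m(2) q'(3) by (meson le_funD order_trans)
  then have "m z = q z"
    using le[of z] linear_neg[OF lin, of z] by simp
  with lin le show thesis by (rule that)
qed

section \<open>Banach lattices\<close>

declare neg_inf_eq_sup [simp del] neg_sup_eq_inf [simp del]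
  diff_inf_eq_sup [simp del] diff_sup_eq_inf [simp del]

lemma norm_abs_eq [simp]: "norm \<bar>x\<bar> = norm x" for x :: "'a::banach_lattice"
  by (intro antisym norm_mono) simp_all

lemma norm_mono_nonneg: "0 \<le> x \<Longrightarrow> x \<le> y \<Longrightarrow> norm x \<le> norm y" for x :: "'a::banach_lattice"
  by (rule norm_mono) (metis abs_of_nonneg order_trans)

section \<open>Norm continuity of the lattice operations and the closed positive cone\<close>

lemma abs_diff_sup_le: "\<bar>sup x z - sup y z\<bar> \<le> \<bar>x - y\<bar>" for x :: "'a::lattice_ab_group_add_abs"
proof -
  have *: "sup x z - sup y z \<le> \<bar>x - y\<bar>" for x y :: 'a
  proof -
    have "x \<le> \<bar>x - y\<bar> + y"
      using abs_ge_self[of "x - y"] by (simp add: algebra_simps)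
    also have "\<dots> \<le> \<bar>x - y\<bar> + sup y z"
      by simp
    finally have "sup x z \<le> \<bar>x - y\<bar> + sup y z"
      by (simp add: add_increasing le_supI2)
    then show ?thesis by (simp add: algebra_simps)
  qed
  show ?thesis
    using *[of x y] *[of y x] by (intro abs_leI) (simp_all add: abs_minus_commute)
qed

lemma norm_sup_diff_le: "norm (sup x z - sup y z) \<le> norm (x - y)" for x :: "'a::banach_lattice"
  by (intro norm_mono abs_diff_sup_le)

lemma tendsto_sup_left:
  fixes f :: "'b \<Rightarrow> 'a::banach_lattice"
  assumes "(f \<longlongrightarrow> l) F"
  shows "((\<lambda>x. sup (f x) c) \<longlongrightarrow> sup l c) F"
proof -
  have "((\<lambda>x. norm (f x - l)) \<longlongrightarrow> 0) F"
    using assms by (simp add: LIM_zero tendsto_norm_zero)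
  then have "((\<lambda>x. sup (f x) c - sup l c) \<longlongrightarrow> 0) F"
    by (rule Lim_null_comparison[rotated]) (intro always_eventually allI norm_sup_diff_le)
  then show ?thesis by (simp add: LIM_zero_iff)
qed

lemma tendsto_inf_left:
  fixes f :: "'b \<Rightarrow> 'a::banach_lattice"
  assumes "(f \<longlongrightarrow> l) F"
  shows "((\<lambda>x. inf (f x) c) \<longlongrightarrow> inf l c) F"
proof -
  have "((\<lambda>x. - sup (- f x) (- c)) \<longlongrightarrow> - sup (- l) (- c)) F"
    by (rule tendsto_minus[OF tendsto_sup_left[OF tendsto_minus[OF assms]]])
  then show ?thesis by (simp only: inf_eq_neg_sup)
qed

text \<open>The cone is the set of fixed points of x -> sup x 0, which is norm continuous.\<close>

lemma closed_nonneg: "closed {x::'a::banach_lattice. 0 \<le> x}"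
  unfolding closed_sequential_limits
proof (intro allI impI, elim conjE)
  fix f and l :: 'a assume f: "\<forall>n. f n \<in> {x. 0 \<le> x}" "f \<longlonglongrightarrow> l"
  have "(\<lambda>n. sup (f n) 0) \<longlonglongrightarrow> sup l 0"
    by (rule tendsto_sup_left[OF f(2)])
  moreover have "sup (f n) 0 = f n" for n
    using f(1) by (simp add: sup_absorb1)
  ultimately have "f \<longlonglongrightarrow> sup l 0"
    by simp
  with f(2) have "sup l 0 = l"
    using LIMSEQ_unique by blast
  then show "l \<in> {x. 0 \<le> x}"
    using sup_ge2[of 0 l] by simp
qed

lemma banach_lattice_tendsto_le:
  fixes f g :: "nat \<Rightarrow> 'a::banach_lattice"
  assumes "f \<longlonglongrightarrow> a" "g \<longlonglongrightarrow> b" "\<And>n. n \<ge> N \<Longrightarrow> f n \<le> g n"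
  shows "a \<le> b"
proof -
  have "(\<lambda>n. g (n + N) - f (n + N)) \<longlonglongrightarrow> b - a"
    by (rule tendsto_diff[OF assms(2)[THEN LIMSEQ_ignore_initial_segment] assms(1)[THEN LIMSEQ_ignore_initial_segment]])
  then have "b - a \<in> {x. 0 \<le> x}"
    by (rule closed_sequentially[OF closed_nonneg, rotated]) (simp add: assms(3))
  then show ?thesis by simp
qed

lemma closed_atLeastAtMost_banach_lattice: "closed {a..b::'a::banach_lattice}"
  unfolding closed_sequential_limits
proof (intro allI impI, elim conjE)
  fix f and l :: 'a assume f: "\<forall>n. f n \<in> {a..b}" "f \<longlonglongrightarrow> l"
  show "l \<in> {a..b}"
    using banach_lattice_tendsto_le[OF tendsto_const f(2), of 0 a]
      banach_lattice_tendsto_le[OF f(2) tendsto_const, of 0 b] f(1) by simp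
qed

text \<open>z \<le> w / n for all n \<ge> 1, and closedness of the cone lets n tend to infinity.
  Later proofs use it after repeating a step n times below a fixed bound.\<close>

lemma archimedean_nonpos:
  fixes z w :: "'a::banach_lattice"
  assumes "\<And>n::nat. real n *\<^sub>R z \<le> w"
  shows "z \<le> 0"
proof -
  have "z \<le> inverse (real (Suc n)) *\<^sub>R w" for n
  proof -
    have "inverse (real (Suc n)) *\<^sub>R (real (Suc n) *\<^sub>R z) \<le> inverse (real (Suc n)) *\<^sub>R w"
      using assms[of "Suc n"] by (intro scaleR_left_mono) auto
    then show ?thesis by simp
  qed
  moreover have "(\<lambda>n. inverse (real (Suc n)) *\<^sub>R w) \<longlonglongrightarrow> 0 *\<^sub>R w"
    by (intro tendsto_intros LIMSEQ_inverse_real_of_nat)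
  ultimately show ?thesis
    using banach_lattice_tendsto_le[OF tendsto_const, of "\<lambda>n. inverse (real (Suc n)) *\<^sub>R w" "0 *\<^sub>R w" 0 z]
    by simp
qed

section \<open>Positive parts, disjointness and norming positive functionals\<close>

lemma pprt_scaleR:
  fixes x :: "'a::banach_lattice"
  assumes "r > 0"
  shows "pprt (r *\<^sub>R x) = r *\<^sub>R pprt x"
proof (rule antisym)
  show "pprt (r *\<^sub>R x) \<le> r *\<^sub>R pprt x"
    unfolding pprt_def using assms by (simp add: scaleR_left_mono scaleR_nonneg_nonneg)
  have "inverse r *\<^sub>R (r *\<^sub>R x) \<le> inverse r *\<^sub>R pprt (r *\<^sub>R x)"
    using assms by (intro scaleR_left_mono) (simp_all add: pprt_def)
  then have "pprt x \<le> inverse r *\<^sub>R pprt (r *\<^sub>R x)"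
    using assms by (simp add: pprt_def[of x] scaleR_nonneg_nonneg)
  then have "r *\<^sub>R pprt x \<le> r *\<^sub>R (inverse r *\<^sub>R pprt (r *\<^sub>R x))"
    using assms by (intro scaleR_left_mono) auto
  then show "r *\<^sub>R pprt x \<le> pprt (r *\<^sub>R x)"
    using assms by simp
qed

lemma pprt_add_le: "pprt (x + y) \<le> pprt x + pprt y" for x :: "'a::lattice_ab_group_add"
  unfolding pprt_def by (intro sup_least add_mono add_nonneg_nonneg) simp_all

lemma pprt_diff_pprt_neg: "pprt x - pprt (- x) = x" for x :: "'a::lattice_ab_group_add"
  using prts[of x] by (simp add: pprt_neg)

lemma abs_eq_pprt_add: "\<bar>x\<bar> = pprt x + pprt (- x)" for x :: "'a::lattice_ab_group_add_abs"
  by (simp add: abs_prts pprt_neg)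

lemma pprt_le_abs: "pprt x \<le> \<bar>x\<bar>" for x :: "'a::lattice_ab_group_add_abs"
  by (simp add: abs_eq_pprt_add)

lemma norm_pprt_le: "norm (pprt x) \<le> norm x" for x :: "'a::banach_lattice"
  by (rule norm_mono) (use pprt_le_abs in simp)

lemma inf_pprt_pprt_neg: "inf (pprt x) (pprt (- x)) = 0" for x :: "'a::lattice_ab_group_add"
proof -
  have "inf (pprt x) (pprt (- x)) = inf (x + pprt (- x)) (0 + pprt (- x))"
    using pprt_diff_pprt_neg[of x] by (metis add_0 diff_eq_eq)
  also have "\<dots> = 0"
    by (subst add_inf_distrib_right[symmetric]) (simp add: pprt_neg nprt_def[symmetric])
  finally show ?thesis .
qed

text \<open>The right side is the infimum of the four sums x + y, x + z, z + y and z + z; by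
  positivity each of them is above inf (x + y) z.\<close>

lemma inf_add_le:
  fixes x y z :: "'a::lattice_ab_group_add"
  assumes "0 \<le> x" "0 \<le> y" "0 \<le> z"
  shows "inf (x + y) z \<le> inf x z + inf y z"
proof -
  have "inf (x + y) z \<le> inf (x + y) (inf (x + z) (inf (z + y) (z + z)))"
    using assms by (simp add: le_infI2 add_increasing add_increasing2)
  also have "\<dots> = inf x z + inf y z"
    by (simp add: add_sup_inf_distribs inf_aci)
  finally show ?thesis .
qed

lemma Riesz_decomposition:
  fixes x y z :: "'a::lattice_ab_group_add"
  assumes "0 \<le> x" "0 \<le> y" "0 \<le> z" "z \<le> x + y"
  obtains a b where "z = a + b" "0 \<le> a" "a \<le> x" "0 \<le> b" "b \<le> y"
proof
  show "z = inf z x + (z - inf z x)" by simp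
  show "0 \<le> inf z x" "inf z x \<le> x" "0 \<le> z - inf z x" using assms by auto
  have "z \<le> y + inf z x"
    using assms by (simp add: add_inf_distrib_left add.commute)
  then show "z - inf z x \<le> y" by (simp only: diff_le_eq)
qed

lemma disjoint_scaleR:
  fixes x y :: "'a::banach_lattice"
  assumes "inf x y = 0" "r \<ge> 0" "0 \<le> x" "0 \<le> y"
  shows "inf (r *\<^sub>R x) y = 0"
proof -
  \<comment> \<open>A common factor for both arguments, at least r so that r x \<le> s x and at
    least 1 so that y \<le> s y; dividing by s then gives an element below inf x y.\<close>
  define s where "s = max r 1"
  have s: "s \<ge> 1" "r \<le> s" by (auto simp: s_def)
  have "inf (r *\<^sub>R x) y \<le> inf (s *\<^sub>R x) (s *\<^sub>R y)"
    using s assms scaleR_right_mono[of 1 s y] by (intro inf_mono scaleR_right_mono) auto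
  also have "\<dots> \<le> 0"
  proof -
    let ?w = "inf (s *\<^sub>R x) (s *\<^sub>R y)"
    have "inverse s *\<^sub>R ?w \<le> inverse s *\<^sub>R (s *\<^sub>R x)" "inverse s *\<^sub>R ?w \<le> inverse s *\<^sub>R (s *\<^sub>R y)"
      using s by (intro scaleR_left_mono; simp)+
    then have "inverse s *\<^sub>R ?w \<le> inf x y"
      using s by simp
    then have "s *\<^sub>R (inverse s *\<^sub>R ?w) \<le> s *\<^sub>R 0"
      using s assms(1) by (intro scaleR_left_mono) auto
    then show ?thesis using s by simp
  qed
  finally show ?thesis
    using assms by (intro antisym) (simp_all add: scaleR_nonneg_nonneg)
qed

text \<open>Hahn-Banach for norm (pprt x) in place of the norm: this sublinear function vanishes at
  - x when x \<ge> 0, which makes f positive.\<close>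

lemma exists_positive_functional:
  fixes z :: "'a::banach_lattice"
  assumes "0 \<le> z"
  obtains f where "bounded_linear f" "\<And>x. 0 \<le> x \<Longrightarrow> 0 \<le> f x" "f z = norm z"
proof -
  have "sublinear (\<lambda>x::'a. norm (pprt x))"
    unfolding sublinear_def
  proof (intro conjI allI impI)
    fix x y :: 'a
    have "norm (pprt (x + y)) \<le> norm (pprt x + pprt y)"
      by (intro norm_mono_nonneg pprt_add_le) simp
    then show "norm (pprt (x + y)) \<le> norm (pprt x) + norm (pprt y)"
      using norm_triangle_ineq order_trans by blast
  qed (simp add: pprt_scaleR)
  then obtain f where f: "linear f" "\<And>x. f x \<le> norm (pprt x)" "f z = norm (pprt z)"
    using Hahn_Banach_sublinear by blast
  have ub: "f x \<le> norm x" for x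
    using f(2) norm_pprt_le order_trans by blast
  have "\<bar>f x\<bar> \<le> norm x * 1" for x
    using ub[of x] ub[of "- x"] linear_neg[OF f(1), of x] by (simp add: abs_le_iff)
  then have "bounded_linear f"
    using f(1) unfolding bounded_linear_def bounded_linear_axioms_def real_norm_def by blast
  moreover have "0 \<le> f x" if "0 \<le> x" for x
    using f(2)[of "- x"] linear_neg[OF f(1), of x] that by simp
  ultimately show thesis
    using f(3) assms by (intro that[of f]) auto
qed

section \<open>Order continuity\<close>

lemma isGlb_UNIV_0I:
  fixes D :: "'a::banach_lattice set"
  assumes "\<And>d. d \<in> D \<Longrightarrow> 0 \<le> d" "\<And>z. (\<And>d. d \<in> D \<Longrightarrow> z \<le> d) \<Longrightarrow> z \<le> 0"
  shows "isGlb UNIV D 0"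
  using assms by (simp add: isGlb_def greatestP_def isLb_def setge_def setle_def)

lemma order_continuousE:
  fixes D :: "'a::banach_lattice set"
  assumes "order_continuous TYPE('a)" "D \<noteq> {}"
    and "\<And>x y. x \<in> D \<Longrightarrow> y \<in> D \<Longrightarrow> \<exists>z\<in>D. z \<le> x \<and> z \<le> y"
    and "\<And>d. d \<in> D \<Longrightarrow> 0 \<le> d" "\<And>z. (\<And>d. d \<in> D \<Longrightarrow> z \<le> d) \<Longrightarrow> z \<le> 0"
    and "\<epsilon> > 0"
  obtains d where "d \<in> D" "norm d < \<epsilon>"
proof -
  have "downward_directed D"
    using assms(2,3) by (simp add: downward_directed_def)
  moreover have "isGlb UNIV D 0"
    using assms(4,5) by (rule isGlb_UNIV_0I)
  ultimately show thesis
    using assms(1,6) that unfolding order_continuous_def by (meson order_refl)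
qed

section \<open>Bounded directed sets and monotone sequences\<close>

text \<open>Substitute for the supremum of A. The differences between upper bounds and members
  decrease to 0: if z lies below all of them, then y - z is an upper bound whenever y is one, so b -
  n z is one for every n, and the Archimedean property gives z \<le> 0.\<close>

lemma upward_directed_approx_bound:
  fixes A :: "'a::banach_lattice set"
  assumes oc: "order_continuous TYPE('a)" and "A \<noteq> {}"
    and dir: "\<And>x y. x \<in> A \<Longrightarrow> y \<in> A \<Longrightarrow> \<exists>z\<in>A. x \<le> z \<and> y \<le> z"
    and bound: "\<And>x. x \<in> A \<Longrightarrow> x \<le> b" and "\<epsilon> > 0"
  obtains a y where "a \<in> A" "\<And>x. x \<in> A \<Longrightarrow> x \<le> y" "norm (y - a) < \<epsilon>"
proof -
  define U where "U = {y. \<forall>x\<in>A. x \<le> y}"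
  define D where "D = {y - a | y a. y \<in> U \<and> a \<in> A}"
  obtain a\<^sub>0 where a0: "a\<^sub>0 \<in> A" using \<open>A \<noteq> {}\<close> by blast
  have b: "b \<in> U" using bound by (simp add: U_def)
  obtain d where "d \<in> D" "norm d < \<epsilon>"
  proof (rule order_continuousE[OF oc, of D \<epsilon>])
    show "D \<noteq> {}" using a0 b by (auto simp: D_def)
  next
    fix x y assume "x \<in> D" "y \<in> D"
    then obtain u a v a' where *: "x = u - a" "y = v - a'" "u \<in> U" "v \<in> U" "a \<in> A" "a' \<in> A"
      by (auto simp: D_def)
    obtain c where c: "c \<in> A" "a \<le> c" "a' \<le> c" using dir[OF *(5,6)] by blast
    have "inf u v \<in> U" using * by (auto simp: U_def)
    then have "inf u v - c \<in> D" using c by (auto simp: D_def)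
    moreover have "inf u v - c \<le> x" "inf u v - c \<le> y"
      using c * by (auto intro: diff_mono)
    ultimately show "\<exists>z\<in>D. z \<le> x \<and> z \<le> y" by blast
  next
    fix d assume "d \<in> D" then show "0 \<le> d" by (auto simp: D_def U_def)
  next
    fix z assume z: "\<And>d. d \<in> D \<Longrightarrow> z \<le> d"
    have step: "y - z \<in> U" if "y \<in> U" for y
    proof -
      have "x \<le> y - z" if "x \<in> A" for x
      proof -
        have "z \<le> y - x" using \<open>y \<in> U\<close> that by (intro z) (auto simp: D_def)
        then show ?thesis by (simp add: algebra_simps)
      qed
      then show ?thesis by (simp add: U_def)
    qed
    have "b - real n *\<^sub>R z \<in> U" for n
    proof (induction n)
      case (Suc n)
      from step[OF this] show ?case by (simp add: algebra_simps)
    qed (simp add: b)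
    then have "a\<^sub>0 \<le> b - real n *\<^sub>R z" for n using a0 by (auto simp: U_def)
    then have "real n *\<^sub>R z \<le> b - a\<^sub>0" for n by (simp add: algebra_simps)
    then show "z \<le> 0" by (rule archimedean_nonpos)
  qed (use \<open>\<epsilon> > 0\<close> in auto)
  then show thesis using that by (auto simp: D_def U_def)
qed

text \<open>All later terms lie between some f N and an upper bound at distance less than \<epsilon>
  / 2 from f N.\<close>

lemma incseq_bounded_convergent:
  fixes f :: "nat \<Rightarrow> 'a::banach_lattice"
  assumes oc: "order_continuous TYPE('a)" and inc: "incseq f" and bound: "\<And>n. f n \<le> b"
  shows "convergent f"
proof -
  have "Cauchy f"
  proof (rule metric_CauchyI)
    fix \<epsilon> :: real assume "\<epsilon> > 0"
    then obtain a y where ay: "a \<in> range f" "\<And>x. x \<in> range f \<Longrightarrow> x \<le> y" "norm (y - a) < \<epsilon> / 2"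
    proof (elim upward_directed_approx_bound[OF oc, of "range f" b "\<epsilon> / 2", rotated -1])
      show "\<exists>z\<in>range f. x \<le> z \<and> y \<le> z" if "x \<in> range f" "y \<in> range f" for x y
      proof -
        from that obtain m n where "x = f m" "y = f n" by blast
        then have "x \<le> f (max m n)" "y \<le> f (max m n)"
          using inc by (simp_all add: incseqD)
        then show ?thesis by blast
      qed
    qed (use bound in auto)
    then obtain N where N: "a = f N" by blast
    have *: "norm (f m - f N) < \<epsilon> / 2" if "m \<ge> N" for m
    proof -
      have "norm (f m - f N) \<le> norm (y - f N)"
        using incseqD[OF inc that] ay(2)[of "f m"] by (intro norm_mono_nonneg) auto
      then show ?thesis using ay(3) N by simp
    qed
    have "dist (f m) (f n) < \<epsilon>" if "m \<ge> N" "n \<ge> N" for m n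
      using *[OF that(1)] *[OF that(2)] dist_triangle2[of "f m" "f n" "f N"]
      by (simp add: dist_norm)
    then show "\<exists>M. \<forall>m\<ge>M. \<forall>n\<ge>M. dist (f m) (f n) < \<epsilon>" by blast
  qed
  then show ?thesis by (simp add: Cauchy_convergent)
qed

lemma decseq_bounded_convergent:
  fixes f :: "nat \<Rightarrow> 'a::banach_lattice"
  assumes oc: "order_continuous TYPE('a)" and dec: "decseq f" and bound: "\<And>n. b \<le> f n"
  shows "convergent f"
proof -
  have "convergent (\<lambda>n. - f n)"
    by (rule incseq_bounded_convergent[OF oc, of _ "- b"]) (use dec bound in \<open>simp_all add: incseq_def decseq_def\<close>)
  then show ?thesis by (subst convergent_minus_iff)
qed

section \<open>A functional that controls the norm on an order interval\<close>

definition positive_functional :: "('a::banach_lattice \<Rightarrow> real) \<Rightarrow> bool" where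
  "positive_functional f \<longleftrightarrow> bounded_linear f \<and> (\<forall>x\<ge>0. 0 \<le> f x)"

lemma positive_functional_mono:
  assumes "positive_functional f" "x \<le> y"
  shows "f x \<le> f y"
proof -
  interpret bounded_linear f using assms by (simp add: positive_functional_def)
  have "0 \<le> f (y - x)" using assms by (simp add: positive_functional_def)
  then show ?thesis by (simp add: diff)
qed

lemma positive_functional_nonneg: "positive_functional f \<Longrightarrow> 0 \<le> x \<Longrightarrow> 0 \<le> f x"
  by (simp add: positive_functional_def)

lemma sup_le_add: "0 \<le> x \<Longrightarrow> 0 \<le> y \<Longrightarrow> sup x y \<le> x + y" for x :: "'a::lattice_ab_group_add"
  by simp

text \<open>The functionals whose null sets in \<open>[0, e]\<close> are dominated by elements of small norm are
  cofinal. For such a functional \<open>f\<close>, the limit superior of a sequence with \<open>f (x n) < 1 / 2 ^ n\<close>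
  is a null element.\<close>

lemma functional_controls_norm:
  fixes e :: "'a::banach_lattice"
  assumes oc: "order_continuous TYPE('a)" and e: "0 \<le> e" and \<epsilon>: "\<epsilon> > 0"
  obtains f \<delta> where "positive_functional f" "\<delta> > 0"
    "\<And>x. 0 \<le> x \<Longrightarrow> x \<le> e \<Longrightarrow> f x < \<delta> \<Longrightarrow> norm x < \<epsilon>"
proof -
  define N where "N f = {x. 0 \<le> x \<and> x \<le> e \<and> f x = 0}" for f :: "'a \<Rightarrow> real"
  \<comment> \<open>Upper bounds of null sets. The infimum of a bound for f1 and a bound for f2 is a
    bound for f1 + f2, since a sum of positive functionals vanishes at a positive element only if
    both do; so D is directed.\<close>
  define D where "D = {y. \<exists>f. positive_functional f \<and> (\<forall>x\<in>N f. x \<le> y)}"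
  have N0: "0 \<in> N f" if "positive_functional f" for f
    using that e linear_0[OF bounded_linear.linear, of f] by (simp add: N_def positive_functional_def)
  have D_nonneg: "0 \<le> y" if "y \<in> D" for y
    using that N0 by (auto simp: D_def)
  obtain y where y: "y \<in> D" "norm y < \<epsilon>"
  proof (rule order_continuousE[OF oc, of D \<epsilon>])
    have "positive_functional (\<lambda>_. 0)" by (simp add: positive_functional_def)
    then have "e \<in> D" by (force simp: D_def N_def)
    then show "D \<noteq> {}" by blast
  next
    fix y1 y2 assume "y1 \<in> D" "y2 \<in> D"
    then obtain f1 f2 where f: "positive_functional f1" "positive_functional f2"
      and le: "\<And>x. x \<in> N f1 \<Longrightarrow> x \<le> y1" "\<And>x. x \<in> N f2 \<Longrightarrow> x \<le> y2"
      by (auto simp: D_def)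
    have "positive_functional (\<lambda>x. f1 x + f2 x)"
      using f by (simp add: positive_functional_def bounded_linear_add)
    moreover have "x \<in> N f1 \<inter> N f2" if "x \<in> N (\<lambda>x. f1 x + f2 x)" for x
      using that positive_functional_nonneg[OF f(1), of x] positive_functional_nonneg[OF f(2), of x]
      by (auto simp: N_def)
    ultimately have "inf y1 y2 \<in> D"
      using le unfolding D_def by (blast intro: inf_greatest)
    then show "\<exists>z\<in>D. z \<le> y1 \<and> z \<le> y2" by (intro bexI[of _ "inf y1 y2"]) auto
  next
    fix z assume z: "\<And>d. d \<in> D \<Longrightarrow> z \<le> d"
    have z': "pprt z \<le> d" if "d \<in> D" for d
      using z[OF that] D_nonneg[OF that] by (simp add: pprt_def)
    have "norm (pprt z) = 0"
    proof (rule ccontr)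
      assume nz: "norm (pprt z) \<noteq> 0"
      obtain f where "bounded_linear f" "\<And>x. 0 \<le> x \<Longrightarrow> 0 \<le> f x" and fz: "f (pprt z) = norm (pprt z)"
        using exists_positive_functional[OF zero_le_pprt] by metis
      then have f: "positive_functional f" unfolding positive_functional_def by blast
      interpret bounded_linear f using f by (simp add: positive_functional_def)
      obtain K where K: "K > 0" "\<And>x. norm (f x) \<le> norm x * K" using pos_bounded by blast
      \<comment> \<open>The null set of f has an upper bound y within norm (pprt z) / K of a null
        element a. Then f y = f (y - a) < norm (pprt z) = f (pprt z), although y is in D and hence
        pprt z \<le> y.\<close>
      obtain a y where ay: "a \<in> N f" "\<And>x. x \<in> N f \<Longrightarrow> x \<le> y" "norm (y - a) < norm (pprt z) / K"
      proof (rule upward_directed_approx_bound[OF oc, of "N f" e "norm (pprt z) / K"])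
        show "N f \<noteq> {}" using N0[OF f] by blast
        show "norm (pprt z) / K > 0" using K nz by (intro divide_pos_pos) auto
        show "x \<le> e" if "x \<in> N f" for x using that by (simp add: N_def)
        fix x x' assume x: "x \<in> N f" "x' \<in> N f"
        then have "f (sup x x') \<le> f (x + x')"
          by (intro positive_functional_mono[OF f] sup_le_add) (simp_all add: N_def)
        then have "f (sup x x') = 0"
          using x positive_functional_nonneg[OF f, of "sup x x'"] by (simp add: N_def add le_supI1)
        then have "sup x x' \<in> N f" using x by (simp add: N_def le_supI1)
        then show "\<exists>z\<in>N f. x \<le> z \<and> x' \<le> z" by (intro bexI[of _ "sup x x'"]) auto
      qed blast
      have "y \<in> D" using ay(2) f by (auto simp: D_def)
      then have "norm (pprt z) \<le> f y"
        using positive_functional_mono[OF f z'] fz by simp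
      also have "f y = f (y - a)" using ay(1) by (simp add: N_def diff)
      also have "\<dots> \<le> norm (y - a) * K" using K(2)[of "y - a"] by simp
      also have "\<dots> < norm (pprt z)" using ay(3) K(1) by (simp add: field_simps)
      finally show False by simp
    qed
    then show "z \<le> 0" by (simp add: le_zero_iff_zero_pprt)
  qed (use D_nonneg \<epsilon> in auto)
  then obtain f where f: "positive_functional f" and Ny: "\<And>x. x \<in> N f \<Longrightarrow> x \<le> y"
    by (auto simp: D_def)
  interpret bounded_linear f using f by (simp add: positive_functional_def)
  have "\<exists>\<delta>>0. \<forall>x. 0 \<le> x \<longrightarrow> x \<le> e \<longrightarrow> f x < \<delta> \<longrightarrow> norm x < \<epsilon>"
  proof (rule ccontr)
    assume neg: "\<not> ?thesis"
    have "\<exists>x. 0 \<le> x \<and> x \<le> e \<and> f x < (1/2) ^ n \<and> \<epsilon> \<le> norm x" for n :: nat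
    proof -
      have "(1/2::real) ^ n > 0" by simp
      with neg show ?thesis by (meson not_less)
    qed
    then obtain x where x: "\<And>n. 0 \<le> x n" "\<And>n. x n \<le> e" "\<And>n. f (x n) < (1/2) ^ n" "\<And>n. \<epsilon> \<le> norm (x n)"
      by metis
    \<comment> \<open>s n m is the supremum of x n, ..., x (n + m). The limits S n in m decrease,
      and their limit u is the limit superior.\<close>
    define s where "s n = rec_nat (x n) (\<lambda>m r. sup r (x (n + Suc m)))" for n
    have s_0: "s n 0 = x n" and s_Suc: "s n (Suc m) = sup (s n m) (x (n + Suc m))" for n m
      by (simp_all add: s_def)
    have s_nonneg: "0 \<le> s n m" and s_le: "s n m \<le> e" and s_ge: "x n \<le> s n m" for n m
      by (induction m) (simp_all add: s_0 s_Suc x le_supI1)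
    \<comment> \<open>The factor 2 - (1/2) ^ m is the sum of (1/2) ^ j over j \<le> m.\<close>
    have fs: "f (s n m) \<le> (1/2) ^ n * (2 - (1/2) ^ m)" for n m
    proof (induction m)
      case (Suc m)
      have "f (s n (Suc m)) \<le> f (s n m + x (n + Suc m))"
        unfolding s_Suc by (intro positive_functional_mono[OF f] sup_le_add s_nonneg x)
      also have "\<dots> \<le> (1/2) ^ n * (2 - (1/2) ^ m) + (1/2) ^ (n + Suc m)"
        unfolding add using Suc.IH x(3)[of "n + Suc m"] by linarith
      also have "\<dots> = (1/2) ^ n * (2 - (1/2) ^ Suc m)"
        by (simp add: power_add field_simps)
      finally show ?case .
    qed (use x(3)[of n] s_0 in simp)
    have fs2: "f (s n m) \<le> (1/2) ^ n * 2" for n m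
      by (rule order_trans[OF fs]) (intro mult_left_mono; simp)
    have s_shift: "s (Suc n) m \<le> s n (Suc m)" for n m
    proof (induction m)
      case (Suc m)
      show ?case
        unfolding s_Suc[of "Suc n" m] s_Suc[of n "Suc m"] using Suc.IH by (intro sup_mono) simp_all
    qed (simp add: s_0 s_Suc)
    have "convergent (s n)" for n
      by (rule incseq_bounded_convergent[OF oc _ s_le]) (simp add: incseq_SucI s_Suc)
    then obtain S where S: "\<And>n. s n \<longlonglongrightarrow> S n" unfolding convergent_def by metis
    have S_le: "S n \<le> e" and S_nonneg: "0 \<le> S n" and S_ge: "x n \<le> S n" for n
      using banach_lattice_tendsto_le[OF S tendsto_const s_le] banach_lattice_tendsto_le[OF tendsto_const S s_nonneg]
        banach_lattice_tendsto_le[OF tendsto_const S s_ge] .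
    have fS: "f (S n) \<le> (1/2) ^ n * 2" for n
      by (rule LIMSEQ_le_const2[OF tendsto[OF S]]) (use fs2 in blast)
    have "decseq S"
      by (rule decseq_SucI) (rule banach_lattice_tendsto_le[OF S LIMSEQ_Suc[OF S] s_shift])
    then have "convergent S" by (rule decseq_bounded_convergent[OF oc _ S_nonneg])
    then obtain u where u: "S \<longlonglongrightarrow> u" unfolding convergent_def by blast
    have u0: "0 \<le> u" "u \<le> e"
      using banach_lattice_tendsto_le[OF tendsto_const u S_nonneg] banach_lattice_tendsto_le[OF u tendsto_const S_le] .
    have "(\<lambda>n. (1/2::real) ^ n * 2) \<longlonglongrightarrow> 0 * 2"
      by (intro tendsto_mult LIMSEQ_realpow_zero tendsto_const) auto
    then have "f u \<le> 0 * 2"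
      by (rule LIMSEQ_le[OF tendsto[OF u]]) (use fS in blast)
    \<comment> \<open>A null element is below y, so norm u < \<epsilon>; but each S n dominates x n
      and has norm at least \<epsilon>.\<close>
    then have "u \<in> N f"
      using u0 positive_functional_nonneg[OF f u0(1)] by (simp add: N_def)
    then have "norm u \<le> norm y" using Ny u0 by (intro norm_mono_nonneg) auto
    moreover have "\<epsilon> \<le> norm u"
    proof (rule LIMSEQ_le_const[OF tendsto_norm[OF u]], intro exI allI impI)
      show "\<epsilon> \<le> norm (S n)" for n
        using x(4)[of n] norm_mono_nonneg[OF x(1) S_ge, of n] by simp
    qed
    ultimately show False using y(2) by simp
  qed
  then show thesis using f that by blast
qed

section \<open>Uniform convexity of order intervals\<close>

text \<open>When the cap rises from t k to t (k + 1), the left side is bounded by pprt (x - t k)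
  plus the old bound and also by pprt (t k - y) plus the old bound, hence by the infimum of the two.
  For real functions this says that x exceeds y by more than one grid step only where some level t j
  lies strictly between them.\<close>

lemma grid_diff_le:
  fixes x y e :: "'a::banach_lattice"
  assumes "M > 0" "0 \<le> y" "0 \<le> e"
  defines "t \<equiv> \<lambda>j::nat. (real j / real M) *\<^sub>R e"
  shows "inf x (t k) - y \<le> (1 / real M) *\<^sub>R e + (\<Sum>j<k. inf (pprt (x - t j)) (pprt (t j - y)))"
proof (induction k)
  case 0
  have "inf x 0 - y \<le> 0" using assms(2) by (simp add: le_infI2)
  also have "0 \<le> (1 / real M) *\<^sub>R e" using assms(3) by (simp add: scaleR_nonneg_nonneg)
  finally show ?case by (simp add: t_def)
next
  case (Suc k)
  let ?c = "(1 / real M) *\<^sub>R e"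
  let ?\<Sigma> = "\<Sum>j<k. inf (pprt (x - t j)) (pprt (t j - y))"
  have t: "t (Suc k) = t k + ?c"
    by (simp add: t_def add_divide_distrib scaleR_add_left)
  have c: "0 \<le> ?c" using assms(3) by (simp add: scaleR_nonneg_nonneg)
  have \<Sigma>: "0 \<le> ?\<Sigma>" by (intro sum_nonneg) simp
  have "x \<le> pprt (x - t k) + inf x (t k)"
  proof -
    have "sup x (t k) = sup (x - t k) 0 + t k"
      by (simp add: add_sup_distrib_right)
    then have "x = sup (x - t k) 0 + inf x (t k)"
      using add_eq_inf_sup[of x "t k"] by (metis add.assoc add.commute add_right_cancel)
    then show ?thesis by (simp add: pprt_def)
  qed
  then have "inf x (t (Suc k)) - y \<le> pprt (x - t k) + (inf x (t k) - y)"
    by (simp add: le_infI1 algebra_simps)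
  also have "\<dots> \<le> pprt (x - t k) + (?c + ?\<Sigma>)"
    using Suc.IH by (rule add_left_mono)
  finally have 1: "inf x (t (Suc k)) - y \<le> pprt (x - t k) + (?c + ?\<Sigma>)" .
  have "inf x (t (Suc k)) - y \<le> (t k - y) + ?c"
    unfolding t by (simp add: le_infI2 algebra_simps)
  also have "\<dots> \<le> pprt (t k - y) + (?c + ?\<Sigma>)"
    using \<Sigma> by (intro add_mono) (simp_all add: pprt_def)
  finally have 2: "inf x (t (Suc k)) - y \<le> pprt (t k - y) + (?c + ?\<Sigma>)" .
  have "inf x (t (Suc k)) - y \<le> inf (pprt (x - t k)) (pprt (t k - y)) + (?c + ?\<Sigma>)"
    using 1 2 by (simp add: add_inf_distrib_right)
  then show ?case by (simp add: ac_simps)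
qed

text \<open>The triangle inequality with its loss, which comes from the places where a and b have
  opposite signs. |a| + |b| - (a + b) is twice the sum of the negative parts and so dominates the
  two infima; the same holds for - a and - b.\<close>

lemma abs_add_le_minus_inf:
  fixes a b :: "'a::lattice_ab_group_add_abs"
  shows "\<bar>a + b\<bar> \<le> \<bar>a\<bar> + \<bar>b\<bar> - (inf (pprt a) (pprt (- b)) + inf (pprt b) (pprt (- a)))"
proof -
  have *: "a + b \<le> \<bar>a\<bar> + \<bar>b\<bar> - (inf (pprt a) (pprt (- b)) + inf (pprt b) (pprt (- a)))" for a b :: 'a
  proof -
    have "inf (pprt a) (pprt (- b)) + inf (pprt b) (pprt (- a)) \<le> pprt (- b) + pprt (- a)"
      by (intro add_mono) simp_all
    also have "\<dots> \<le> (pprt (- b) + pprt (- a)) + (pprt (- b) + pprt (- a))"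
      by simp
    also have "\<dots> = \<bar>a\<bar> + \<bar>b\<bar> - (a + b)"
      using pprt_diff_pprt_neg[of a] pprt_diff_pprt_neg[of b]
      by (simp add: abs_eq_pprt_add algebra_simps)
    finally show ?thesis by (simp add: algebra_simps)
  qed
  show ?thesis
    using *[of a b] *[of "- a" "- b"] by (intro abs_leI) (simp_all add: inf_commute add.commute)
qed

text \<open>Where x and y differ by more than a grid step, some level t j separates them, x - t j
  and y - t j have opposite signs, and midpoint convexity of x -> f |x - t j| shows a loss. Summed
  over the grid, the losses bound f |x - y| up to the grid error f e / M, and f controls the norm at
  the scale \<epsilon>.\<close>

lemma order_interval_uniformly_convex:
  fixes e :: "'a::banach_lattice"
  assumes oc: "order_continuous TYPE('a)" and e: "0 \<le> e" and \<epsilon>: "\<epsilon> > 0"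
  obtains q :: "'a \<Rightarrow> real" and \<delta> where "\<delta> > 0" "\<And>x. x \<in> {0..e} \<Longrightarrow> 0 \<le> q x \<and> q x \<le> 1"
    "\<And>x y. x \<in> {0..e} \<Longrightarrow> y \<in> {0..e} \<Longrightarrow> 0 \<le> q x + q y - 2 * q ((1/2) *\<^sub>R (x + y))"
    "\<And>x y. x \<in> {0..e} \<Longrightarrow> y \<in> {0..e} \<Longrightarrow> q x + q y - 2 * q ((1/2) *\<^sub>R (x + y)) < \<delta> \<Longrightarrow> norm (x - y) < \<epsilon>"
proof -
  obtain f \<delta>\<^sub>0 where f: "positive_functional f" and \<delta>0: "\<delta>\<^sub>0 > 0"
    and small: "\<And>x. 0 \<le> x \<Longrightarrow> x \<le> e \<Longrightarrow> f x < \<delta>\<^sub>0 \<Longrightarrow> norm x < \<epsilon>"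
    using functional_controls_norm[OF assms] by blast
  interpret bounded_linear f using f by (simp add: positive_functional_def)
  note f_mono = positive_functional_mono[OF f] and f_nonneg = positive_functional_nonneg[OF f]
  have fe: "0 \<le> f e" using f_nonneg e by simp
  obtain M :: nat where M0: "M > 0" and M: "f e / real M < \<delta>\<^sub>0 / 2"
  proof -
    obtain n :: nat where n: "2 * f e / \<delta>\<^sub>0 < real n" using reals_Archimedean2 by blast
    have "f e / real (Suc n) < \<delta>\<^sub>0 / 2"
      using n \<delta>0 fe by (simp add: field_simps)
    then show thesis using that by blast
  qed
  define t where "t j = (real j / real M) *\<^sub>R e" for j :: nat
  \<comment> \<open>Each of the M summands of q is at most f e, so dividing by c makes q at most 1;
    the added 1 keeps c positive when f e = 0.\<close>
  define c where "c = real M * f e + 1"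
  have c: "c > 0" using fe by (simp add: c_def add_nonneg_pos)
  define q where "q x = (\<Sum>j<M. f \<bar>x - t j\<bar>) / c" for x
  define h where "h x y j = inf (pprt (x - t j)) (pprt (t j - y))" for x y j
  have h_nonneg: "0 \<le> h x y j" for x y j by (simp add: h_def)
  have t: "0 \<le> t j" "t j \<le> e" if "j < M" for j
    using that e scaleR_right_mono[of "real j / real M" 1 e] by (auto simp: t_def scaleR_nonneg_nonneg)
  have diff_le: "x - y \<le> (1 / real M) *\<^sub>R e + (\<Sum>j<M. h x y j)" if "x \<in> {0..e}" "y \<in> {0..e}" for x y
  proof -
    have "inf x (t M) = x" using that M0 by (simp add: t_def inf_absorb1)
    then show ?thesis
      using grid_diff_le[OF M0, of y e x M] that e by (simp add: t_def h_def)
  qed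
  have gap: "f \<bar>x - y\<bar> - f e / real M \<le> c * (q x + q y - 2 * q ((1/2) *\<^sub>R (x + y)))"
    and gap0: "0 \<le> c * (q x + q y - 2 * q ((1/2) *\<^sub>R (x + y)))"
    if xy: "x \<in> {0..e}" "y \<in> {0..e}" for x y
  proof -
    let ?z = "(1/2) *\<^sub>R (x + y)"
    have "f (h x y j) + f (h y x j) \<le> f \<bar>x - t j\<bar> + f \<bar>y - t j\<bar> - 2 * f \<bar>?z - t j\<bar>" for j
    proof -
      have "f \<bar>(x - t j) + (y - t j)\<bar> \<le> f (\<bar>x - t j\<bar> + \<bar>y - t j\<bar> - (h x y j + h y x j))"
        using abs_add_le_minus_inf[of "x - t j" "y - t j"] by (intro f_mono) (simp add: h_def)
      moreover have "f \<bar>(x - t j) + (y - t j)\<bar> = 2 * f \<bar>?z - t j\<bar>"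
      proof -
        have "(x - t j) + (y - t j) = (?z - t j) + (?z - t j)"
          by (simp add: scaleR_half_double algebra_simps flip: scaleR_add_left)
        moreover have "\<bar>w + w\<bar> = \<bar>w\<bar> + \<bar>w\<bar>" for w :: 'a
        proof (rule antisym)
          have "w \<le> (1/2) *\<^sub>R \<bar>w + w\<bar>" "- w \<le> (1/2) *\<^sub>R \<bar>w + w\<bar>"
            using scaleR_left_mono[OF abs_ge_self[of "w + w"], of "1/2"]
              scaleR_left_mono[OF abs_ge_minus_self[of "w + w"], of "1/2"]
            by (simp_all flip: scaleR_2)
          then have "\<bar>w\<bar> \<le> (1/2) *\<^sub>R \<bar>w + w\<bar>" by (rule abs_leI)
          then have "\<bar>w\<bar> + \<bar>w\<bar> \<le> (1/2) *\<^sub>R \<bar>w + w\<bar> + (1/2) *\<^sub>R \<bar>w + w\<bar>" by (rule add_mono) fact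
          then show "\<bar>w\<bar> + \<bar>w\<bar> \<le> \<bar>w + w\<bar>" by (simp flip: scaleR_add_left)
        qed (rule abs_triangle_ineq)
        ultimately have "\<bar>(x - t j) + (y - t j)\<bar> = \<bar>?z - t j\<bar> + \<bar>?z - t j\<bar>" by metis
        then show ?thesis by (metis add mult_2)
      qed
      ultimately show ?thesis by (simp add: add diff)
    qed
    then have "(\<Sum>j<M. f (h x y j) + f (h y x j)) \<le> (\<Sum>j<M. f \<bar>x - t j\<bar> + f \<bar>y - t j\<bar> - 2 * f \<bar>?z - t j\<bar>)"
      by (rule sum_mono)
    also have "\<dots> = c * (q x + q y - 2 * q ?z)"
      using c by (simp add: q_def sum.distrib sum_subtractf field_simps sum_distrib_left)
    finally have *: "(\<Sum>j<M. f (h x y j) + f (h y x j)) \<le> c * (q x + q y - 2 * q ?z)" .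
    then show "0 \<le> c * (q x + q y - 2 * q ?z)"
      by (rule order_trans[rotated]) (intro sum_nonneg add_nonneg_nonneg f_nonneg h_nonneg)
    have "\<bar>x - y\<bar> \<le> (1 / real M) *\<^sub>R e + (\<Sum>j<M. h x y j + h y x j)"
    proof (rule abs_leI)
      have "(\<Sum>j<M. h x y j) \<le> (\<Sum>j<M. h x y j + h y x j)" "(\<Sum>j<M. h y x j) \<le> (\<Sum>j<M. h x y j + h y x j)"
        by (intro sum_mono; simp add: h_nonneg)+
      then show "x - y \<le> (1 / real M) *\<^sub>R e + (\<Sum>j<M. h x y j + h y x j)"
        "- (x - y) \<le> (1 / real M) *\<^sub>R e + (\<Sum>j<M. h x y j + h y x j)"
        using diff_le[OF xy] diff_le[OF xy(2,1)] by (auto intro: order_trans add_left_mono)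
    qed
    then have "f \<bar>x - y\<bar> \<le> f ((1 / real M) *\<^sub>R e + (\<Sum>j<M. h x y j + h y x j))" by (rule f_mono)
    also have "\<dots> = f e / real M + (\<Sum>j<M. f (h x y j) + f (h y x j))"
      by (simp add: add scaleR sum)
    finally show "f \<bar>x - y\<bar> - f e / real M \<le> c * (q x + q y - 2 * q ?z)" using * by simp
  qed
  show thesis
  \<comment> \<open>The gap, rescaled by c, uses one half of \<open>\<delta>\<^sub>0\<close>; the
    grid error, by the choice of M, stays below the other half.\<close>
  proof (rule that[of "\<delta>\<^sub>0 / (2 * c)" q])
    show "\<delta>\<^sub>0 / (2 * c) > 0" using \<delta>0 c by simp
    show "0 \<le> q x \<and> q x \<le> 1" if x: "x \<in> {0..e}" for x
    proof
      show "0 \<le> q x" unfolding q_def using c by (intro divide_nonneg_pos sum_nonneg f_nonneg) auto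
      have "f \<bar>x - t j\<bar> \<le> f e" if "j < M" for j
      proof (intro f_mono abs_leI)
        show "x - t j \<le> e" using x t[OF that] by (simp add: diff_le_eq add_increasing2)
        show "- (x - t j) \<le> e" using x t[OF that] by (simp add: diff_le_eq add_increasing2)
      qed
      then have "(\<Sum>j<M. f \<bar>x - t j\<bar>) \<le> (\<Sum>j<M. f e)" by (intro sum_mono) auto
      then show "q x \<le> 1" using c by (simp add: q_def c_def)
    qed
    fix x y assume xy: "x \<in> {0..e}" "y \<in> {0..e}"
    show "0 \<le> q x + q y - 2 * q ((1/2) *\<^sub>R (x + y))"
      using gap0[OF xy] c by (simp add: zero_le_mult_iff)
    assume "q x + q y - 2 * q ((1/2) *\<^sub>R (x + y)) < \<delta>\<^sub>0 / (2 * c)"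
    then have "c * (q x + q y - 2 * q ((1/2) *\<^sub>R (x + y))) < \<delta>\<^sub>0 / 2"
      using c by (simp add: field_simps)
    then have "f \<bar>x - y\<bar> < \<delta>\<^sub>0" using gap[OF xy] M by linarith
    moreover have "\<bar>x - y\<bar> \<le> e"
    proof (rule abs_leI)
      show "x - y \<le> e" using xy by (simp add: diff_le_eq add_increasing2)
      show "- (x - y) \<le> e" using xy by (simp add: diff_le_eq add_increasing2)
    qed
    ultimately have "norm \<bar>x - y\<bar> < \<epsilon>" by (intro small) simp_all
    then show "norm (x - y) < \<epsilon>" by simp
  qed
qed

section \<open>Weak compactness\<close>

lemma continuous_map_weak_topology:
  assumes "bounded_linear f"
  shows "continuous_map weak_topology euclideanreal f"
proof -
  have "openin weak_topology (f -` U)" if "open U" for U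
    unfolding weak_topology_def using assms that by (intro topology_generated_by_Basis) blast
  then show ?thesis by (simp add: continuous_map_alt)
qed

section \<open>Weak compactness from uniform convexity\<close>

text \<open>The intersection argument for bounded closed convex sets in a uniformly convex space,
  with Q in the role of the norm: near-minimisers of Q in one member are close, because their
  midpoint stays in that member and Q cannot fall much there. Q may be discontinuous, so the limit
  point is caught by closedness of the members and not as a minimiser.\<close>

lemma uniformly_convex_fip:
  fixes C :: "'a::banach set"
  assumes uc: "\<And>\<epsilon>. \<epsilon> > 0 \<Longrightarrow> \<exists>(q::'a \<Rightarrow> real) \<delta>. \<delta> > 0 \<and> (\<forall>x\<in>C. 0 \<le> q x \<and> q x \<le> 1) \<and>
      (\<forall>x\<in>C. \<forall>y\<in>C. 0 \<le> q x + q y - 2 * q ((1/2) *\<^sub>R (x + y)) \<and>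
        (q x + q y - 2 * q ((1/2) *\<^sub>R (x + y)) < \<delta> \<longrightarrow> norm (x - y) < \<epsilon>))"
    and ne: "\<D> \<noteq> {}"
    and \<D>: "\<And>D. D \<in> \<D> \<Longrightarrow> D \<noteq> {} \<and> D \<subseteq> C \<and> closed D"
    and mid: "\<And>D x y. D \<in> \<D> \<Longrightarrow> x \<in> D \<Longrightarrow> y \<in> D \<Longrightarrow> (1/2) *\<^sub>R (x + y) \<in> D"
    and Int: "\<And>D D'. D \<in> \<D> \<Longrightarrow> D' \<in> \<D> \<Longrightarrow> D \<inter> D' \<in> \<D>"
  shows "\<Inter>\<D> \<noteq> {}"
proof -
  have "\<forall>n. \<exists>(q::'a \<Rightarrow> real) \<delta>. \<delta> > 0 \<and> (\<forall>x\<in>C. 0 \<le> q x \<and> q x \<le> 1) \<and>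
      (\<forall>x\<in>C. \<forall>y\<in>C. 0 \<le> q x + q y - 2 * q ((1/2) *\<^sub>R (x + y)) \<and>
        (q x + q y - 2 * q ((1/2) *\<^sub>R (x + y)) < \<delta> \<longrightarrow> norm (x - y) < inverse (real (Suc n))))"
    by (intro allI uc) simp
  then obtain q :: "nat \<Rightarrow> 'a \<Rightarrow> real" and \<delta> where q: "\<And>n. \<delta> n > 0" "\<And>n x. x \<in> C \<Longrightarrow> 0 \<le> q n x \<and> q n x \<le> 1"
      "\<And>n x y. x \<in> C \<Longrightarrow> y \<in> C \<Longrightarrow> 0 \<le> q n x + q n y - 2 * q n ((1/2) *\<^sub>R (x + y))"
      "\<And>n x y. x \<in> C \<Longrightarrow> y \<in> C \<Longrightarrow> q n x + q n y - 2 * q n ((1/2) *\<^sub>R (x + y)) < \<delta> n \<Longrightarrow>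
         norm (x - y) < inverse (real (Suc n))"
    by metis
  \<comment> \<open>The n-th term handles the precision 1 / (n + 1). All gaps are nonnegative, so a
    gap of Q below (1/2) ^ n * \<delta> n forces the gap of q n below \<delta> n.\<close>
  define Q where "Q x = (\<Sum>n. (1/2) ^ n * q n x)" for x
  have summ: "summable (\<lambda>n. (1/2) ^ n * q n x)" if "x \<in> C" for x
  proof (rule summable_comparison_test')
    show "summable (\<lambda>n. (1/2::real) ^ n)" by simp
    show "norm ((1/2) ^ n * q n x) \<le> (1/2) ^ n" for n
      using q(2)[OF that, of n] by (simp add: mult_left_le)
  qed
  have Q0: "0 \<le> Q x" if "x \<in> C" for x
    unfolding Q_def using q(2)[OF that] by (intro suminf_nonneg summ that) simp
  have Q2: "Q x \<le> 2" if "x \<in> C" for x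
  proof -
    have "Q x \<le> (\<Sum>n. (1/2::real) ^ n)"
      unfolding Q_def using q(2)[OF that] by (intro suminf_le summ that) (simp_all add: mult_left_le)
    then show ?thesis using suminf_geometric[of "1/2::real"] by simp
  qed
  have gap: "norm (x - y) < inverse (real (Suc n))"
    if xy: "x \<in> C" "y \<in> C" "(1/2) *\<^sub>R (x + y) \<in> C"
      and lt: "Q x + Q y - 2 * Q ((1/2) *\<^sub>R (x + y)) < (1/2) ^ n * \<delta> n" for x y n
  proof (rule q(4)[OF xy(1,2)])
    let ?g = "\<lambda>n. (1/2) ^ n * (q n x + q n y - 2 * q n ((1/2) *\<^sub>R (x + y)))"
    have "(\<lambda>n. (1/2) ^ n * q n x + (1/2) ^ n * q n y - 2 * ((1/2) ^ n * q n ((1/2) *\<^sub>R (x + y))))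
        sums (Q x + Q y - 2 * Q ((1/2) *\<^sub>R (x + y)))"
      unfolding Q_def by (intro sums_diff sums_add sums_mult summable_sums summ xy)
    then have sums: "?g sums (Q x + Q y - 2 * Q ((1/2) *\<^sub>R (x + y)))"
      by (simp add: algebra_simps)
    have "?g n \<le> suminf ?g"
      using sum_le_suminf[OF sums_summable[OF sums], of "{n}"] q(3)[OF xy(1,2)] by simp
    also have "\<dots> < (1/2) ^ n * \<delta> n"
      using lt sums_unique[OF sums] by simp
    finally show "q n x + q n y - 2 * q n ((1/2) *\<^sub>R (x + y)) < \<delta> n" by simp
  qed
  \<comment> \<open>The infimum of Q grows as the members shrink; m is its limiting value.\<close>
  define m where "m = (SUP D\<in>\<D>. INF x\<in>D. Q x)"
  have bddQ: "bdd_below (Q ` D)" if "D \<in> \<D>" for D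
    by (rule bdd_belowI[of _ 0]) (use Q0 \<D>[OF that] in blast)
  have INF_le2: "(INF x\<in>D. Q x) \<le> 2" if D: "D \<in> \<D>" for D
  proof -
    obtain x where "x \<in> D" using \<D>[OF D] by blast
    then show ?thesis using cINF_lower[OF bddQ[OF D]] Q2[of x] \<D>[OF D] by fastforce
  qed
  have bddI: "bdd_above ((\<lambda>D. INF x\<in>D. Q x) ` \<D>)"
    by (rule bdd_aboveI[of _ 2]) (use INF_le2 in blast)
  \<comment> \<open>4 \<eta> n is the threshold in \<open>gap\<close>: two points with Q < m +
    \<eta> n whose midpoint has Q > m - \<eta> n have a gap of Q below 4 \<eta> n.\<close>
  define \<eta> where "\<eta> n = (1/2) ^ n * \<delta> n / 4" for n
  have \<eta>: "\<eta> n > 0" for n using q(1)[of n] by (simp add: \<eta>_def)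
  have near: "\<exists>x\<in>D. Q x < m + t" if D: "D \<in> \<D>" and "t > 0" for D t
  proof -
    have "(INF x\<in>D. Q x) \<le> m" unfolding m_def by (rule cSUP_upper[OF D bddI])
    also have "m < m + t" using that by simp
    finally have "(INF x\<in>D. Q x) < m + t" .
    moreover have "D \<noteq> {}" using \<D>[OF D] by blast
    ultimately show ?thesis using cINF_less_iff[OF _ bddQ[OF D], of "m + t"] by metis
  qed
  have "\<forall>n. \<exists>D\<in>\<D>. \<forall>x\<in>D. m - \<eta> n < Q x"
  proof
    fix n
    have "m - \<eta> n < m" using \<eta> by simp
    then obtain D where D: "D \<in> \<D>" "m - \<eta> n < (INF x\<in>D. Q x)"
      unfolding m_def using less_cSUP_iff[OF ne bddI] by blast
    moreover have "(INF x\<in>D. Q x) \<le> Q x" if "x \<in> D" for x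
      using that by (rule cINF_lower[OF bddQ[OF D(1)]])
    ultimately show "\<exists>D\<in>\<D>. \<forall>x\<in>D. m - \<eta> n < Q x"
      by (intro bexI[of _ D] ballI) (auto intro: order_less_le_trans)
  qed
  then obtain D where D: "\<And>n. D n \<in> \<D>" "\<And>n x. x \<in> D n \<Longrightarrow> m - \<eta> n < Q x" by metis
  have close: "norm (x - y) < inverse (real (Suc n))"
    if x: "x \<in> D n" "Q x < m + \<eta> n" and y: "y \<in> D n" "Q y < m + \<eta> n" for x y n
  proof (rule gap)
    have z: "(1/2) *\<^sub>R (x + y) \<in> D n" by (rule mid[OF D(1) x(1) y(1)])
    show "x \<in> C" "y \<in> C" "(1/2) *\<^sub>R (x + y) \<in> C" using x y z \<D>[OF D(1), of n] by blast+
    have "Q x + Q y - 2 * Q ((1/2) *\<^sub>R (x + y)) < 4 * \<eta> n" using D(2)[OF z] x y by simp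
    then show "Q x + Q y - 2 * Q ((1/2) *\<^sub>R (x + y)) < (1/2) ^ n * \<delta> n" by (simp add: \<eta>_def)
  qed
  have fin: "(\<Inter>k\<le>n. D k) \<in> \<D>" for n
    by (induction n) (simp_all add: atMost_Suc D(1) Int)
  \<comment> \<open>Every B in the family contains points that almost minimise Q on D 0, ..., D n
    simultaneously. By \<open>close\<close>, sequences picked from different B have the same limit,
    which therefore lies in all of them.\<close>
  have pick: "\<exists>x. \<forall>n. x n \<in> B \<and> (\<forall>k\<le>n. x n \<in> D k \<and> Q (x n) < m + \<eta> k)" if B: "B \<in> \<D>" for B
  proof (intro choice allI)
    fix n
    have "Min (\<eta> ` {..n}) > 0" using \<eta> by simp
    then obtain x where x: "x \<in> B \<inter> (\<Inter>k\<le>n. D k)" "Q x < m + Min (\<eta> ` {..n})"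
      using near[OF Int[OF B fin]] by blast
    have "Q x < m + \<eta> k" if "k \<le> n" for k
    proof -
      have "Min (\<eta> ` {..n}) \<le> \<eta> k" using that by simp
      then show ?thesis using x(2) by linarith
    qed
    then show "\<exists>x. x \<in> B \<and> (\<forall>k\<le>n. x \<in> D k \<and> Q x < m + \<eta> k)"
      using x(1) by blast
  qed
  obtain x where x: "\<And>n k. k \<le> n \<Longrightarrow> x n \<in> D k \<and> Q (x n) < m + \<eta> k"
    using pick[OF D(1)] by blast
  have "Cauchy x"
  proof (rule metric_CauchyI)
    fix \<epsilon> :: real assume "\<epsilon> > 0"
    then obtain N where N: "inverse (real (Suc N)) < \<epsilon>" using reals_Archimedean by blast
    have "dist (x i) (x j) < \<epsilon>" if "i \<ge> N" "j \<ge> N" for i j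
      using close[of "x i" N "x j"] x[OF that(1)] x[OF that(2)] N by (simp add: dist_norm)
    then show "\<exists>N. \<forall>i\<ge>N. \<forall>j\<ge>N. dist (x i) (x j) < \<epsilon>" by blast
  qed
  then obtain z where z: "x \<longlonglongrightarrow> z" using Cauchy_convergent convergent_def by blast
  have "z \<in> B" if B: "B \<in> \<D>" for B
  proof -
    obtain y where y: "\<And>n. y n \<in> B" "\<And>n k. k \<le> n \<Longrightarrow> y n \<in> D k \<and> Q (y n) < m + \<eta> k"
      using pick[OF B] by blast
    have "(\<lambda>n. y n - x n) \<longlonglongrightarrow> 0"
    proof (rule Lim_null_comparison[OF always_eventually LIMSEQ_inverse_real_of_nat], intro allI)
      show "norm (y n - x n) \<le> inverse (real (Suc n))" for n
        using close[of "y n" n "x n"] x[of n n] y(2)[of n n] by simp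
    qed
    from tendsto_add[OF this z] have "y \<longlonglongrightarrow> z" by simp
    then show ?thesis using closed_sequentially[of B y z] y(1) \<D>[OF B] by blast
  qed
  then show ?thesis by blast
qed

text \<open>By the Alexander subbase theorem only covers by half-spaces matter. If no finite
  subfamily covers C, the complements in C of finite unions are nonempty, closed, convex and stable
  under intersection, so \<open>uniformly_convex_fip\<close> gives a point of C outside the whole
  cover.\<close>

lemma uniformly_convex_weakly_compact:
  fixes C :: "'a::banach set"
  assumes uc: "\<And>\<epsilon>. \<epsilon> > 0 \<Longrightarrow> \<exists>(q::'a \<Rightarrow> real) \<delta>. \<delta> > 0 \<and> (\<forall>x\<in>C. 0 \<le> q x \<and> q x \<le> 1) \<and>
      (\<forall>x\<in>C. \<forall>y\<in>C. 0 \<le> q x + q y - 2 * q ((1/2) *\<^sub>R (x + y)) \<and>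
        (q x + q y - 2 * q ((1/2) *\<^sub>R (x + y)) < \<delta> \<longrightarrow> norm (x - y) < \<epsilon>))"
    and "closed C" "convex C"
  shows "weakly_compact C"
proof -
  define \<B> where "\<B> = {{x. f x < c} | (f::'a \<Rightarrow> real) c. bounded_linear f}"
  \<comment> \<open>The topology on C with the half-spaces as subbase. Its identity map into the
    weak topology is continuous, as a < f x is a half-space for - f, and carries compactness
    over.\<close>
  define X where "X = topology (arbitrary union_of (finite intersection_of (\<lambda>x. x \<in> \<B>) relative_to C))"
  have topX: "topspace X = C" by (simp add: X_def)
  have "compact_space X"
  proof (rule Alexander_subbase_alt[where U = C and \<B> = \<B>])
    have "UNIV = {x::'a. (0::real) < 1}" by simp
    then have "UNIV \<in> \<B>"
      unfolding \<B>_def mem_Collect_eq using bounded_linear_zero by (intro exI[of _ "\<lambda>_. 0"] exI[of _ 1]) auto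
    then show "C \<subseteq> \<Union>\<B>" by blast
    fix \<C> assume \<C>: "\<C> \<subseteq> \<B>" "C \<subseteq> \<Union>\<C>"
    show "\<exists>\<C>'. finite \<C>' \<and> \<C>' \<subseteq> \<C> \<and> C \<subseteq> \<Union>\<C>'"
    proof (rule ccontr)
      assume neg: "\<not> ?thesis"
      define \<D> where "\<D> = {C - \<Union>F | F. finite F \<and> F \<subseteq> \<C>}"
      have halfspace: "closed (- U)" "convex (- U)" if "U \<in> \<B>" for U
      proof -
        obtain f :: "'a \<Rightarrow> real" and c where f: "bounded_linear f" "U = {x. f x < c}" using \<open>U \<in> \<B>\<close> unfolding \<B>_def by blast
        then have U: "- U = f -` {c..}" by auto
        show "closed (- U)"
          unfolding U using f(1) by (intro closed_vimage linear_continuous_on) (auto simp: linear_continuous_on)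
        show "convex (- U)"
          unfolding U using f(1) by (intro convex_linear_vimage bounded_linear.linear) auto
      qed
      have "\<Inter>\<D> \<noteq> {}"
      proof (rule uniformly_convex_fip[OF uc])
        show "\<D> \<noteq> {}" by (auto simp: \<D>_def)
      next
        fix D assume "D \<in> \<D>"
        then obtain F where F: "finite F" "F \<subseteq> \<C>" "D = C - \<Union>F" by (auto simp: \<D>_def)
        have D: "D = C \<inter> (\<Inter>U\<in>F. - U)" using F by blast
        have "closed D"
          unfolding D using F \<C> halfspace(1) by (intro closed_Int closed_INT assms) blast
        then show "D \<noteq> {} \<and> D \<subseteq> C \<and> closed D" using neg F by blast
        have "convex D"
          unfolding D using F \<C> halfspace(2) by (intro convex_Int convex_INT assms) blast
        then show "(1/2) *\<^sub>R (x + y) \<in> D" if "x \<in> D" "y \<in> D" for x y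
          using convexD[of D x y "1/2" "1/2"] that by (simp add: scaleR_add_right)
      next
        fix D D' assume "D \<in> \<D>" "D' \<in> \<D>"
        then obtain F F' where F: "finite F" "F \<subseteq> \<C>" "D = C - \<Union>F" "finite F'" "F' \<subseteq> \<C>" "D' = C - \<Union>F'"
          by (auto simp: \<D>_def)
        then have "D \<inter> D' = C - \<Union>(F \<union> F')" "finite (F \<union> F')" "F \<union> F' \<subseteq> \<C>" by auto
        then show "D \<inter> D' \<in> \<D>" unfolding \<D>_def mem_Collect_eq by (intro exI[of _ "F \<union> F'"] conjI)
      qed
      then obtain z where z: "z \<in> \<Inter>\<D>" by blast
      have "C - \<Union>{} \<in> \<D>" unfolding \<D>_def by blast
      then have "z \<in> C" using z by blast
      then obtain U where U: "U \<in> \<C>" "z \<in> U" using \<C> by blast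
      then have "C - \<Union>{U} \<in> \<D>" unfolding \<D>_def by blast
      then show False using z U by blast
    qed
  qed (simp add: X_def)
  have lt: "openin X {x \<in> topspace X. f x < c}" if "bounded_linear f" for f :: "'a \<Rightarrow> real" and c
  proof -
    have "{x. f x < c} \<in> \<B>" using that by (auto simp: \<B>_def)
    then have "(finite intersection_of (\<lambda>x. x \<in> \<B>) relative_to C) (C \<inter> {x. f x < c})"
      by (intro relative_to_inc finite_intersection_of_inc)
    then have "openin X (C \<inter> {x. f x < c})"
      unfolding X_def openin_subbase by (rule arbitrary_union_of_inc)
    then show ?thesis unfolding topX by (simp add: Int_def)
  qed
  have "continuous_map X weak_topology id"
    unfolding weak_topology_def
  proof (rule continuous_on_generated_topo)
    fix S assume "S \<in> {f -` U | (f :: 'a \<Rightarrow> real) U. bounded_linear f \<and> open U}"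
    then obtain f :: "'a \<Rightarrow> real" and U where f: "S = f -` U" "bounded_linear f" "open U" by blast
    have "continuous_map X euclideanreal f"
      unfolding continuous_map_upper_lower_semicontinuous_lt
    proof (intro conjI allI)
      fix a show "openin X {x \<in> topspace X. f x < a}" by (rule lt[OF f(2)])
      show "openin X {x \<in> topspace X. a < f x}"
        using lt[OF bounded_linear_minus[OF f(2)], of "- a"] by simp
    qed
    then show "openin X (id -` S \<inter> topspace X)"
      using f(1,3) unfolding continuous_map_alt by simp
  next
    have "\<Union> {f -` U |(f :: 'a \<Rightarrow> real) U. bounded_linear f \<and> open U} = UNIV"
      using topspace_weak_topology[where 'a='a] unfolding weak_topology_def topology_generated_by_topspace .
    then show "id ` topspace X \<subseteq> \<Union> {f -` U |(f :: 'a \<Rightarrow> real) U. bounded_linear f \<and> open U}"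
      by (simp only: subset_UNIV)
  qed
  then have "compactin weak_topology (id ` C)"
    using \<open>compact_space X\<close> topX by (intro image_compactin) (simp_all add: compact_space_def)
  then show ?thesis by (simp add: weakly_compact_def)
qed

lemma weakly_compact_order_interval:
  fixes e :: "'a::banach_lattice"
  assumes oc: "order_continuous TYPE('a)" and e: "0 \<le> e"
  shows "weakly_compact {0..e}"
proof (rule uniformly_convex_weakly_compact)
  show "closed {0..e}" by (rule closed_atLeastAtMost_banach_lattice)
  show "convex {0..e}"
  proof (rule convexI)
    fix x y and u v :: real
    assume *: "x \<in> {0..e}" "y \<in> {0..e}" "0 \<le> u" "0 \<le> v" "u + v = 1"
    have "u *\<^sub>R x + v *\<^sub>R y \<le> u *\<^sub>R e + v *\<^sub>R e"
      using * by (intro add_mono scaleR_left_mono) auto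
    also have "\<dots> = e" using * by (simp flip: scaleR_add_left)
    finally show "u *\<^sub>R x + v *\<^sub>R y \<in> {0..e}"
      using * by (simp add: add_nonneg_nonneg scaleR_nonneg_nonneg)
  qed
  fix \<epsilon> :: real assume "\<epsilon> > 0"
  from order_interval_uniformly_convex[OF oc e this] obtain q :: "'a \<Rightarrow> real" and \<delta>
    where "\<delta> > 0" "\<And>x. x \<in> {0..e} \<Longrightarrow> 0 \<le> q x \<and> q x \<le> 1"
    "\<And>x y. x \<in> {0..e} \<Longrightarrow> y \<in> {0..e} \<Longrightarrow> 0 \<le> q x + q y - 2 * q ((1/2) *\<^sub>R (x + y))"
    "\<And>x y. x \<in> {0..e} \<Longrightarrow> y \<in> {0..e} \<Longrightarrow> q x + q y - 2 * q ((1/2) *\<^sub>R (x + y)) < \<delta> \<Longrightarrow> norm (x - y) < \<epsilon>"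
    by metis
  then show "\<exists>(q::'a \<Rightarrow> real) \<delta>. \<delta> > 0 \<and> (\<forall>x\<in>{0..e}. 0 \<le> q x \<and> q x \<le> 1) \<and>
      (\<forall>x\<in>{0..e}. \<forall>y\<in>{0..e}. 0 \<le> q x + q y - 2 * q ((1/2) *\<^sub>R (x + y)) \<and>
        (q x + q y - 2 * q ((1/2) *\<^sub>R (x + y)) < \<delta> \<longrightarrow> norm (x - y) < \<epsilon>))"
    by blast
qed

section \<open>Unions of weakly compact sets that shrink to 0\<close>

text \<open>Induction along \<open>generate_topology_on\<close>: the conclusion passes to finite
  intersections and to unions, so that \<open>fin\<close> is applied to one functional at a
  time.\<close>

lemma weak_neighbourhood_0_cofinite:
  fixes I :: "'b \<Rightarrow> 'a::real_normed_vector set"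
  assumes fin: "\<And>f \<epsilon>. bounded_linear f \<Longrightarrow> \<epsilon> > 0 \<Longrightarrow> finite {e\<in>E. \<exists>x\<in>I e. \<epsilon> \<le> \<bar>f x :: real\<bar>}"
    and "openin weak_topology U" "0 \<in> U"
  shows "finite {e\<in>E. \<not> I e \<subseteq> U}"
proof -
  have "generate_topology_on {f -` U | (f :: 'a \<Rightarrow> real) U. bounded_linear f \<and> open U} U"
    using assms(2) unfolding weak_topology_def by (rule openin_topology_generated_by)
  then show ?thesis using \<open>0 \<in> U\<close>
  proof induction
    case (Int U V)
    then have "finite ({e\<in>E. \<not> I e \<subseteq> U} \<union> {e\<in>E. \<not> I e \<subseteq> V})" by simp
    then show ?case by (rule rev_finite_subset) blast
  next
    case (UN \<K>)
    then obtain V where "V \<in> \<K>" "finite {e\<in>E. \<not> I e \<subseteq> V}" by blast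
    then show ?case by (elim rev_finite_subset) blast
  next
    case (Basis S)
    then obtain f :: "'a \<Rightarrow> real" and U where f: "S = f -` U" "bounded_linear f" "open U" by blast
    have "f 0 = 0" using f(2) by (simp add: linear_0 bounded_linear.linear)
    then obtain \<epsilon> where \<epsilon>: "\<epsilon> > 0" "\<And>y. \<bar>y\<bar> < \<epsilon> \<Longrightarrow> y \<in> U"
      using Basis(2) f(1,3) open_dist[of U] by (auto simp: dist_real_def)
    from fin[OF f(2) \<epsilon>(1)] show ?case
    proof (rule rev_finite_subset)
      show "{e\<in>E. \<not> I e \<subseteq> S} \<subseteq> {e\<in>E. \<exists>x\<in>I e. \<epsilon> \<le> \<bar>f x\<bar>}"
        using \<epsilon>(2) f(1) by (force simp: not_le[symmetric])
    qed
  qed simp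
qed

text \<open>The member of a cover that contains 0 swallows all but finitely many of the sets I
  e.\<close>

lemma weakly_compact_insert_0_UN:
  fixes I :: "'b \<Rightarrow> 'a::real_normed_vector set"
  assumes "\<And>e. e \<in> E \<Longrightarrow> weakly_compact (I e)"
    and fin: "\<And>f \<epsilon>. bounded_linear f \<Longrightarrow> \<epsilon> > 0 \<Longrightarrow> finite {e\<in>E. \<exists>x\<in>I e. \<epsilon> \<le> \<bar>f x :: real\<bar>}"
  shows "weakly_compact (insert 0 (\<Union>e\<in>E. I e))"
  unfolding weakly_compact_def compactin_def
proof (intro conjI allI impI)
  fix \<U> assume \<U>: "(\<forall>U\<in>\<U>. openin weak_topology U) \<and> insert 0 (\<Union>e\<in>E. I e) \<subseteq> \<Union>\<U>"
  then obtain U where U: "U \<in> \<U>" "0 \<in> U" "openin weak_topology U" by blast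
  define J where "J = {e\<in>E. \<not> I e \<subseteq> U}"
  have "finite J" unfolding J_def by (rule weak_neighbourhood_0_cofinite[OF fin U(3,2)])
  then have "compactin weak_topology (\<Union>(I ` J))"
    using assms(1) by (intro compactin_Union) (auto simp: J_def weakly_compact_def)
  moreover have "\<Union>(I ` J) \<subseteq> \<Union>\<U>" using \<U> by (auto simp: J_def)
  ultimately obtain \<F> where \<F>: "finite \<F>" "\<F> \<subseteq> \<U>" "\<Union>(I ` J) \<subseteq> \<Union>\<F>"
    using \<U> unfolding compactin_def by metis
  show "\<exists>\<F>. finite \<F> \<and> \<F> \<subseteq> \<U> \<and> insert 0 (\<Union>e\<in>E. I e) \<subseteq> \<Union>\<F>"
  proof (intro exI conjI)
    show "insert 0 (\<Union>e\<in>E. I e) \<subseteq> \<Union>(insert U \<F>)" using \<F>(3) U(2) by (auto simp: J_def)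
  qed (use \<F> U in auto)
qed simp

section \<open>The Schur argument for weakly compact sets\<close>

text \<open>Otherwise every point has a neighbourhood visited at finitely many indices only, and
  finitely many of these cover K. Visits are counted by index, so k may repeat values.\<close>

lemma weakly_compact_cluster_point:
  assumes K: "weakly_compact K" and k: "\<And>n::nat. k n \<in> K"
  shows "\<exists>c. \<forall>U. openin weak_topology U \<longrightarrow> c \<in> U \<longrightarrow> infinite {n. k n \<in> U}"
proof (rule ccontr)
  assume "\<not> ?thesis"
  then obtain U where U: "\<And>c. openin weak_topology (U c)" "\<And>c. c \<in> U c" "\<And>c. finite {n. k n \<in> U c}"
    by metis
  have "\<forall>V\<in>range U. openin weak_topology V" "K \<subseteq> \<Union>(range U)" using U by blast+
  then obtain \<F> where \<F>: "finite \<F>" "\<F> \<subseteq> range U" "K \<subseteq> \<Union>\<F>"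
    using K unfolding weakly_compact_def compactin_def by metis
  have "(UNIV::nat set) = (\<Union>V\<in>\<F>. {n. k n \<in> V})" using \<F>(3) k by blast
  moreover have "finite (\<Union>V\<in>\<F>. {n. k n \<in> V})" using \<F>(1,2) U(3) by blast
  ultimately show False by simp
qed

text \<open>A gliding hump argument, as in the proof of Schur's theorem on \<open>\<ell>\<^sup>1\<close>: \<open>h\<close> separates the
  weak cluster points of the subsequence \<open>k \<circ> r\<close> from \<open>c\<close> although all \<open>g m\<close> agree on them.\<close>

lemma not_weakly_compact_gliding_hump:
  fixes g :: "nat \<Rightarrow> 'a::real_normed_vector \<Rightarrow> real"
  assumes K: "weakly_compact K" and k: "\<And>n. k n \<in> K"
    and lin: "\<And>n. bounded_linear (g n)"
    and bound: "\<And>x N. (\<Sum>n<N. \<bar>g n x\<bar>) \<le> M * norm x"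
    and "\<epsilon> > 0" "\<And>n. \<epsilon> \<le> g n (k n)"
  shows False
proof -
  have summ: "summable (\<lambda>n. \<bar>g n x\<bar>)" for x
    using bound[where x = x] by (intro summableI_nonneg_bounded) auto
  have g_diff: "g n (x - y) = g n x - g n y" for n x y
    using lin[of n] by (simp add: linear_diff bounded_linear.linear)
  obtain c where c: "\<And>U. openin weak_topology U \<Longrightarrow> c \<in> U \<Longrightarrow> infinite {n. k n \<in> U}"
    using weakly_compact_cluster_point[of K k, OF K k] by metis
  have tail: "\<exists>N. \<forall>m\<ge>N. \<forall>n. (\<Sum>i\<in>{m..<n}. \<bar>g i x\<bar>) < \<epsilon> / 8" for x
  proof -
    have "\<epsilon> / 8 > 0" using \<open>\<epsilon> > 0\<close> by simp
    from summable_Cauchy[THEN iffD1, OF summ[of x], rule_format, OF this] obtain N where N: "\<And>m n. m \<ge> N \<Longrightarrow> norm (\<Sum>i\<in>{m..<n}. \<bar>g i x\<bar>) < \<epsilon> / 8"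
      by blast
    have "(\<Sum>i\<in>{m..<n}. \<bar>g i x\<bar>) < \<epsilon> / 8" if "m \<ge> N" for m n
      using N[OF that, of n] by (simp add: sum_nonneg)
    then show ?thesis by blast
  qed
  \<comment> \<open>Beyond r0 the coordinates of c are below \<epsilon> / 8, so that g (r i) (k (r
    i) - c) is at least 7 * \<epsilon> / 8.\<close>
  obtain r0 where r0: "\<And>n. n \<ge> r0 \<Longrightarrow> \<bar>g n c\<bar> < \<epsilon> / 8"
  proof -
    obtain N where N: "\<And>m n. m \<ge> N \<Longrightarrow> (\<Sum>i\<in>{m..<n}. \<bar>g i c\<bar>) < \<epsilon> / 8" using tail by blast
    have "\<bar>g n c\<bar> < \<epsilon> / 8" if "n \<ge> N" for n using N[OF that, of "Suc n"] by simp
    then show thesis using that by blast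
  qed
  \<comment> \<open>Passage from index a to b: from b on the coordinates of k a - c are negligible,
    up to a those of k b - c are. The factor 1 / (i + 1) makes the latter tend to 0 along the
    subsequence.\<close>
  define Q where "Q i a b \<longleftrightarrow> a < b \<and> (\<forall>n. (\<Sum>j\<in>{b..<n}. \<bar>g j (k a - c)\<bar>) < \<epsilon> / 8) \<and>
      (\<Sum>j\<le>a. \<bar>g j (k b - c)\<bar>) < \<epsilon> / 8 / real (Suc i)" for i a b :: nat
  have "\<exists>r. \<forall>i. r i \<ge> r0 \<and> Q i (r i) (r (Suc i))"
  proof (rule dependent_nat_choice)
    fix a i assume "a \<ge> r0"
    let ?U = "{x \<in> topspace weak_topology. (\<Sum>j\<le>a. \<bar>g j x - g j c\<bar>) \<in> {..<\<epsilon> / 8 / real (Suc i)}}"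
    have "continuous_map weak_topology euclideanreal (\<lambda>x. \<Sum>j\<le>a. \<bar>g j x - g j c\<bar>)"
      by (intro continuous_map_sum continuous_map_real_abs continuous_map_diff)
        (simp_all add: continuous_map_weak_topology lin)
    then have "openin weak_topology ?U"
      by (rule openin_continuous_map_preimage) (simp flip: open_openin)
    then have inf: "infinite {n. k n \<in> ?U}" using \<open>\<epsilon> > 0\<close> by (intro c) auto
    obtain N where N: "\<And>m n. m \<ge> N \<Longrightarrow> (\<Sum>j\<in>{m..<n}. \<bar>g j (k a - c)\<bar>) < \<epsilon> / 8" using tail by blast
    obtain b where "b > max a (max r0 N)" "k b \<in> ?U"
      using inf unfolding infinite_nat_iff_unbounded by blast
    then have "b \<ge> r0 \<and> Q i a b" unfolding Q_def using N by (auto simp: g_diff)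
    then show "\<exists>b. b \<ge> r0 \<and> Q i a b" by blast
  qed auto
  then obtain r where r: "\<And>i. r i \<ge> r0" "\<And>i. r i < r (Suc i)"
    "\<And>i n. (\<Sum>j\<in>{r (Suc i)..<n}. \<bar>g j (k (r i) - c)\<bar>) < \<epsilon> / 8"
    "\<And>i. (\<Sum>j\<le>r i. \<bar>g j (k (r (Suc i)) - c)\<bar>) < \<epsilon> / 8 / real (Suc i)"
    unfolding Q_def by blast
  have mono: "strict_mono r" using r(2) by (rule strict_mono_Suc_iff[THEN iffD2, rule_format])
  have r_sum: "(\<Sum>j\<in>J. \<bar>g (r j) x\<bar>) \<le> (\<Sum>m\<in>B. \<bar>g m x\<bar>)" if "finite B" "r ` J \<subseteq> B" for J B x
  proof -
    have "(\<Sum>j\<in>J. \<bar>g (r j) x\<bar>) = (\<Sum>m\<in>r ` J. \<bar>g m x\<bar>)"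
      using strict_mono_imp_inj_on[OF mono] by (subst sum.reindex) (auto intro: inj_on_subset)
    also have "\<dots> \<le> (\<Sum>m\<in>B. \<bar>g m x\<bar>)" using that by (intro sum_mono2) auto
    finally show ?thesis .
  qed
  have bound': "(\<Sum>j<N. \<bar>g (r j) x\<bar>) \<le> M * norm x" for N x
    by (rule order_trans[OF r_sum bound[of x "r N"]]) (use strict_monoD[OF mono] in auto)
  have summ': "summable (\<lambda>j. \<bar>g (r j) x\<bar>)" for x
    using bound'[where x = x] by (intro summableI_nonneg_bounded) auto
  have summ'': "summable (\<lambda>j. g (r j) x)" for x using summ'[of x] by (rule summable_rabs_cancel)
  define h where "h x = (\<Sum>j. g (r j) x)" for x
  have "bounded_linear h"
  proof (rule bounded_linear_intro)
    show "h (x + y) = h x + h y" for x y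
      unfolding h_def using lin by (subst suminf_add[OF summ'' summ'']) (simp add: linear_add bounded_linear.linear)
    show "h (a *\<^sub>R x) = a *\<^sub>R h x" for a x
      unfolding h_def using lin by (simp add: suminf_mult[OF summ''] linear_scale bounded_linear.linear)
    show "norm (h x) \<le> norm x * M" for x
    proof -
      have "\<bar>h x\<bar> \<le> (\<Sum>j. \<bar>g (r j) x\<bar>)" unfolding h_def by (rule summable_rabs[OF summ'])
      also have "\<dots> \<le> M * norm x" by (rule suminf_le_const[OF summ' bound'])
      finally show ?thesis by (simp add: mult.commute)
    qed
  qed
  \<comment> \<open>The hump at r i carries at least 7/8 of \<epsilon>; the terms before and after
    it cost at most 1/8 each.\<close>
  have h_large: "\<epsilon> / 2 \<le> h (k (r i) - c)" for i
  proof -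
    let ?y = "k (r i) - c"
    have low: "\<bar>\<Sum>j<i. g (r j) ?y\<bar> \<le> \<epsilon> / 8"
    proof (cases i)
      case (Suc i')
      have "(\<Sum>j<i. \<bar>g (r j) ?y\<bar>) \<le> (\<Sum>m\<le>r i'. \<bar>g m ?y\<bar>)"
        using Suc by (intro r_sum) (auto simp: strict_mono_less_eq[OF mono])
      also have "\<dots> < \<epsilon> / 8 / real (Suc i')" using r(4)[of i'] Suc by simp
      also have "\<dots> \<le> \<epsilon> / 8" using \<open>\<epsilon> > 0\<close> by (simp add: field_simps)
      finally show ?thesis using sum_abs[of "\<lambda>j. g (r j) ?y" "{..<i}"] by linarith
    qed (use \<open>\<epsilon> > 0\<close> in simp)
    have middle: "7 * \<epsilon> / 8 \<le> g (r i) ?y"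
      using assms(6)[of "r i"] r0[OF r(1)[of i]] by (simp add: g_diff abs_less_iff)
    have "5 * \<epsilon> / 8 \<le> (\<Sum>j<N. g (r j) ?y)" if "N > i" for N
    proof -
      have "(\<Sum>j\<in>{Suc i..<N}. \<bar>g (r j) ?y\<bar>) \<le> (\<Sum>m\<in>{r (Suc i)..<r N}. \<bar>g m ?y\<bar>)"
        by (intro r_sum) (auto simp: strict_mono_less_eq[OF mono] strict_mono_less[OF mono])
      also have "\<dots> < \<epsilon> / 8" by (rule r(3))
      finally have "\<bar>\<Sum>j\<in>{Suc i..<N}. g (r j) ?y\<bar> \<le> \<epsilon> / 8"
        using sum_abs[of "\<lambda>j. g (r j) ?y" "{Suc i..<N}"] by linarith
      moreover have "(\<Sum>j<N. g (r j) ?y) = (\<Sum>j<i. g (r j) ?y) + (g (r i) ?y + (\<Sum>j\<in>{Suc i..<N}. g (r j) ?y))"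
        using that sum.atLeastLessThan_concat[of 0 i N "\<lambda>j. g (r j) ?y"] sum.atLeast_Suc_lessThan[of i N "\<lambda>j. g (r j) ?y"]
        by (simp add: atLeast0LessThan)
      ultimately show ?thesis using low middle by linarith
    qed
    then have "5 * \<epsilon> / 8 \<le> h ?y"
      unfolding h_def by (intro LIMSEQ_le_const[OF summable_LIMSEQ[OF summ'']]) (meson Suc_le_lessD)
    then show ?thesis using \<open>\<epsilon> > 0\<close> by linarith
  qed
  have kr: "k (r n) \<in> K" for n by (rule k)
  obtain c' where c': "\<And>U. openin weak_topology U \<Longrightarrow> c' \<in> U \<Longrightarrow> infinite {n. k (r n) \<in> U}"
    using weakly_compact_cluster_point[of K "\<lambda>n. k (r n)", OF K kr] by metis
  \<comment> \<open>Here the factor 1 / (i + 1) enters: g m (k (r n)) tends to g m c, while it is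
    close to g m c' infinitely often.\<close>
  have "g m c' = g m c" for m
  proof (rule ccontr)
    assume "g m c' \<noteq> g m c"
    define d where "d = \<bar>g m c' - g m c\<bar>"
    have d: "d > 0" using \<open>g m c' \<noteq> g m c\<close> by (simp add: d_def)
    let ?U = "{x \<in> topspace weak_topology. \<bar>g m x - g m c'\<bar> \<in> {..<d / 2}}"
    have "continuous_map weak_topology euclideanreal (\<lambda>x. \<bar>g m x - g m c'\<bar>)"
      by (intro continuous_map_real_abs continuous_map_diff) (simp_all add: continuous_map_weak_topology lin)
    then have "openin weak_topology ?U"
      by (rule openin_continuous_map_preimage) (simp flip: open_openin)
    then have inf: "infinite {n. k (r n) \<in> ?U}" using d by (intro c') auto
    obtain N where N: "inverse (real (Suc N)) < d / 2 / (\<epsilon> / 8)"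
      using reals_Archimedean[of "d / 2 / (\<epsilon> / 8)"] d \<open>\<epsilon> > 0\<close> by auto
    obtain n where n: "n > max m N" "k (r n) \<in> ?U"
      using inf unfolding infinite_nat_iff_unbounded by blast
    then obtain i where i: "n = Suc i" "i \<ge> m" "i \<ge> N" by (cases n) auto
    have "\<bar>g m (k (r n) - c)\<bar> \<le> (\<Sum>j\<le>r i. \<bar>g j (k (r n) - c)\<bar>)"
      using i strict_mono_imp_increasing[OF mono, of i] by (intro member_le_sum) auto
    also have "\<dots> < \<epsilon> / 8 / real (Suc i)" using r(4)[of i] i by simp
    also have "\<dots> \<le> \<epsilon> / 8 * inverse (real (Suc N))" using i \<open>\<epsilon> > 0\<close> by (simp add: field_simps)
    also have "\<dots> < d / 2" using N \<open>\<epsilon> > 0\<close> by (simp add: field_simps)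
    finally have "\<bar>g m (k (r n)) - g m c\<bar> < d / 2" by (simp add: g_diff)
    moreover have "\<bar>g m (k (r n)) - g m c'\<bar> < d / 2" using n(2) by simp
    ultimately show False by (simp add: d_def abs_if split: if_splits)
  qed
  then have "h c' = h c" by (simp add: h_def)
  \<comment> \<open>h agrees at c and c', yet h (k (r n)) stays at least \<epsilon> / 2 above h c,
    so no k (r n) lies in this neighbourhood of c'.\<close>
  let ?U = "{x \<in> topspace weak_topology. h x \<in> {..<h c + \<epsilon> / 2}}"
  have "openin weak_topology ?U"
    by (rule openin_continuous_map_preimage[OF continuous_map_weak_topology[OF \<open>bounded_linear h\<close>]])
      (simp flip: open_openin)
  then have "infinite {n. k (r n) \<in> ?U}"
    using \<open>h c' = h c\<close> \<open>\<epsilon> > 0\<close> by (intro c') auto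
  then obtain n where "k (r n) \<in> ?U" using not_finite_existsD by blast
  moreover have "h (k (r n) - c) = h (k (r n)) - h c"
    using \<open>bounded_linear h\<close> by (simp add: linear_diff bounded_linear.linear)
  ultimately show False using h_large[of n] by simp
qed

text \<open>Restricting to the indices with |g n (k n)| \<ge> \<epsilon> and multiplying by signs
  preserves the bound on the sums and gives the positive values that the hump argument
  expects.\<close>

lemma weakly_compact_l1_null:
  fixes g :: "nat \<Rightarrow> 'a::real_normed_vector \<Rightarrow> real"
  assumes K: "weakly_compact K" and k: "\<And>n. k n \<in> K"
    and lin: "\<And>n. bounded_linear (g n)"
    and bound: "\<And>x N. (\<Sum>n<N. \<bar>g n x\<bar>) \<le> M * norm x"
    and "\<epsilon> > 0"
  shows "finite {n. \<epsilon> \<le> \<bar>g n (k n)\<bar>}"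
proof (rule ccontr)
  let ?A = "{n. \<epsilon> \<le> \<bar>g n (k n)\<bar>}"
  assume inf: "infinite ?A"
  let ?r = "enumerate ?A"
  have mono: "strict_mono ?r" using inf by (rule strict_mono_enumerate)
  define s where "s j = sgn (g (?r j) (k (?r j)))" for j
  have s: "\<bar>s j\<bar> \<le> 1" for j by (simp add: s_def sgn_if)
  show False
  proof (rule not_weakly_compact_gliding_hump[OF K, of "k \<circ> ?r" "\<lambda>j x. s j * g (?r j) x" M \<epsilon>])
    show "bounded_linear (\<lambda>x. s n * g (?r n) x)" for n
      by (intro bounded_linear_const_mult lin)
    show "(\<Sum>n<N. \<bar>s n * g (?r n) x\<bar>) \<le> M * norm x" for x N
    proof -
      have "(\<Sum>n<N. \<bar>s n * g (?r n) x\<bar>) \<le> (\<Sum>n<N. \<bar>g (?r n) x\<bar>)"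
        using s by (intro sum_mono) (simp add: abs_mult mult_left_le_one_le)
      also have "\<dots> = (\<Sum>m\<in>?r ` {..<N}. \<bar>g m x\<bar>)"
        using strict_mono_imp_inj_on[OF mono] by (subst sum.reindex) (auto intro: inj_on_subset)
      also have "\<dots> \<le> (\<Sum>m<?r N. \<bar>g m x\<bar>)" using strict_monoD[OF mono] by (intro sum_mono2) auto
      finally show ?thesis using bound order_trans by blast
    qed
    show "\<epsilon> \<le> s n * g (?r n) ((k \<circ> ?r) n)" for n
      using enumerate_in_set[OF inf, of n] by (simp add: s_def abs_sgn mult.commute)
  qed (use k \<open>\<epsilon> > 0\<close> in auto)
qed

section \<open>Disjoint elements below a weakly compact set\<close>

text \<open>Kantorovich's extension g x = G (x^+) - G (x^-). Additivity results from applying G to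
  (x + y)^+ + x^- + y^- = (x + y)^- + x^+ + y^+, where all terms are positive.\<close>

lemma bounded_linear_cone_extension:
  fixes G :: "'a::banach_lattice \<Rightarrow> real"
  assumes add: "\<And>x y. 0 \<le> x \<Longrightarrow> 0 \<le> y \<Longrightarrow> G (x + y) = G x + G y"
    and scale: "\<And>r x. r > 0 \<Longrightarrow> 0 \<le> x \<Longrightarrow> G (r *\<^sub>R x) = r * G x"
    and bound: "\<And>x. 0 \<le> x \<Longrightarrow> \<bar>G x\<bar> \<le> M * norm x"
  obtains g where "bounded_linear g" "\<And>x. 0 \<le> x \<Longrightarrow> g x = G x"
proof -
  define g where "g x = G (pprt x) - G (pprt (- x))" for x
  have G0: "G 0 = 0" using add[of 0 0] by simp
  have M: "0 \<le> M * norm x" for x :: 'a using bound[of "\<bar>x\<bar>"] by simp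
  have "bounded_linear g"
  proof (rule bounded_linear_intro)
    fix x y :: 'a
    have "pprt (x + y) + (pprt (- x) + pprt (- y)) = pprt (- (x + y)) + (pprt x + pprt y)"
      using pprt_diff_pprt_neg[of x] pprt_diff_pprt_neg[of y] pprt_diff_pprt_neg[of "x + y"]
      by (simp add: algebra_simps)
    then have "G (pprt (x + y) + (pprt (- x) + pprt (- y))) = G (pprt (- (x + y)) + (pprt x + pprt y))"
      by (rule arg_cong)
    then show "g (x + y) = g x + g y"
      by (simp add: g_def add add_nonneg_nonneg)
  next
    fix r :: real and x :: 'a
    consider "r > 0" | "r = 0" | "r < 0" by linarith
    then show "g (r *\<^sub>R x) = r *\<^sub>R g x"
    proof cases
      case 1
      then show ?thesis
        using pprt_scaleR[OF 1, of x] pprt_scaleR[OF 1, of "- x"] by (simp add: g_def scale algebra_simps)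
    next
      case 2
      then show ?thesis by (simp add: g_def)
    next
      case 3
      then have "- r > 0" by simp
      from pprt_scaleR[OF this, of x] pprt_scaleR[OF this, of "- x"] scale[OF this, of "pprt x"]
        scale[OF this, of "pprt (- x)"]
      show ?thesis by (simp add: g_def algebra_simps)
    qed
  next
    fix x :: 'a
    have "\<bar>G (pprt x)\<bar> \<le> M * norm x" "\<bar>G (pprt (- x))\<bar> \<le> M * norm x"
    proof -
      \<comment> \<open>M is seen to be nonnegative only once some element has nonzero norm, hence
        the case distinction.\<close>
      have *: "\<bar>G (pprt x)\<bar> \<le> M * norm x" for x :: 'a
      proof (cases "norm (pprt x) = 0")
        case True
        then show ?thesis using G0 M[of x] by simp
      next
        case False
        then have "M \<ge> 0" using M[of "pprt x"] by (simp add: zero_le_mult_iff)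
        then have "M * norm (pprt x) \<le> M * norm x" using norm_pprt_le by (intro mult_left_mono) auto
        then show ?thesis using bound[of "pprt x"] by simp
      qed
      show "\<bar>G (pprt x)\<bar> \<le> M * norm x" by (rule *)
      show "\<bar>G (pprt (- x))\<bar> \<le> M * norm x" using *[of "- x"] by simp
    qed
    moreover have "norm x * (2 * M) = M * norm x + M * norm x" by simp
    ultimately show "norm (g x) \<le> norm x * (2 * M)" unfolding g_def real_norm_def by linarith
  qed
  moreover have "g x = G x" if "0 \<le> x" for x using that G0 by (simp add: g_def)
  ultimately show thesis by (rule that)
qed

text \<open>The functional \<open>g\<close> is the composition of the positive part of \<open>f\<close> with the projection onto
  the band generated by \<open>x\<close>.\<close>

lemma positive_part_on_principal_ideal:
  fixes x :: "'a::banach_lattice"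
  assumes f: "bounded_linear f" and x: "0 \<le> x"
  obtains g :: "'a \<Rightarrow> real" where "bounded_linear g" "\<And>y. 0 \<le> y \<Longrightarrow> 0 \<le> g y"
    "\<And>y z t. 0 \<le> z \<Longrightarrow> z \<le> y \<Longrightarrow> z \<le> t *\<^sub>R x \<Longrightarrow> f z \<le> g y"
    "\<And>y \<epsilon>. 0 \<le> y \<Longrightarrow> \<epsilon> > 0 \<Longrightarrow> \<exists>z t. 0 \<le> z \<and> z \<le> y \<and> 0 \<le> t \<and> z \<le> t *\<^sub>R x \<and> g y < f z + \<epsilon>"
proof -
  interpret bounded_linear f by fact
  obtain K where K: "\<And>x. norm (f x) \<le> norm x * K" "K > 0" using pos_bounded by blast
  \<comment> \<open>The Riesz-Kantorovich formula for the positive part of f, with the supremum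
    restricted to elements of [0, y] below a multiple of x; the restriction stands in for the band
    projection.\<close>
  define A where "A y = {z. 0 \<le> z \<and> z \<le> y \<and> (\<exists>t. 0 \<le> t \<and> z \<le> t *\<^sub>R x)}" for y
  define G where "G y = Sup (f ` A y)" for y
  have f_le: "\<bar>f z\<bar> \<le> K * norm y" if "z \<in> A y" for z y
  proof -
    have "norm z * K \<le> norm y * K"
      using that K(2) by (intro mult_right_mono norm_mono_nonneg) (auto simp: A_def)
    then show ?thesis using K(1)[of z] by (simp add: mult.commute)
  qed
  have A0: "0 \<in> A y" if "0 \<le> y" for y
    using that by (auto simp: A_def intro!: exI[of _ 0])
  have bdd: "bdd_above (f ` A y)" for y
    using f_le by (intro bdd_aboveI[of _ "K * norm y"]) fastforce
  have upper: "f z \<le> G y" if "z \<in> A y" for z y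
    unfolding G_def using that by (intro cSUP_upper bdd)
  have least: "G y \<le> c" if "0 \<le> y" "\<And>z. z \<in> A y \<Longrightarrow> f z \<le> c" for y c
    unfolding G_def using A0[OF that(1)] that(2) by (intro cSUP_least) auto
  have G_nonneg: "0 \<le> G y" if "0 \<le> y" for y
    using upper[OF A0[OF that]] by (simp add: zero)
  have A_scale: "r *\<^sub>R z \<in> A (r *\<^sub>R y)" if r: "r > 0" and z: "z \<in> A y" for r z y
  proof -
    obtain t where t: "0 \<le> t" "z \<le> t *\<^sub>R x" using z by (auto simp: A_def)
    have "r *\<^sub>R z \<le> (r * t) *\<^sub>R x" using scaleR_left_mono[OF t(2), of r] r by simp
    moreover have "0 \<le> r * t" using r t by simp
    ultimately show ?thesis using r z unfolding A_def
      by (auto intro!: scaleR_left_mono scaleR_nonneg_nonneg)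
  qed
  have scale_le: "r * G y \<le> G (r *\<^sub>R y)" if "r > 0" "0 \<le> y" for r y
  proof -
    have "G y \<le> G (r *\<^sub>R y) / r"
    proof (rule least[OF that(2)])
      fix z assume "z \<in> A y"
      from upper[OF A_scale[OF that(1) this]] show "f z \<le> G (r *\<^sub>R y) / r"
        using that by (simp add: scaleR field_simps)
    qed
    then show ?thesis using that by (simp add: field_simps)
  qed
  obtain g where g: "bounded_linear g" "\<And>y. 0 \<le> y \<Longrightarrow> g y = G y"
  proof (rule bounded_linear_cone_extension[of G K])
    fix y1 y2 :: 'a assume y: "0 \<le> y1" "0 \<le> y2"
    show "G (y1 + y2) = G y1 + G y2"
    proof (rule antisym)
      show "G (y1 + y2) \<le> G y1 + G y2"
      proof (rule least)
        fix z assume z: "z \<in> A (y1 + y2)"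
        then obtain t where t: "0 \<le> t" "z \<le> t *\<^sub>R x" "0 \<le> z" "z \<le> y1 + y2" by (auto simp: A_def)
        \<comment> \<open>The Riesz summands of z stay below z, thus below the same multiple of x,
          and are admissible in \<open>A y1\<close> and \<open>A y2\<close>.\<close>
        obtain a b where ab: "z = a + b" "0 \<le> a" "a \<le> y1" "0 \<le> b" "b \<le> y2"
          using Riesz_decomposition[OF y t(3,4)] by blast
        have "a \<le> z" "b \<le> z" using ab by simp_all
        then have "a \<le> t *\<^sub>R x" "b \<le> t *\<^sub>R x" using t(2) by (blast intro: order_trans)+
        then have "a \<in> A y1" "b \<in> A y2" using ab t(1) by (auto simp: A_def)
        then show "f z \<le> G y1 + G y2" using upper ab(1) by (simp add: add add_mono)
      qed (use y in simp)
      have *: "f z1 + f z2 \<le> G (y1 + y2)" if z: "z1 \<in> A y1" "z2 \<in> A y2" for z1 z2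
      proof -
        obtain t1 t2 where t: "0 \<le> t1" "z1 \<le> t1 *\<^sub>R x" "0 \<le> t2" "z2 \<le> t2 *\<^sub>R x"
          using z by (auto simp: A_def)
        have "z1 + z2 \<le> (t1 + t2) *\<^sub>R x" using t by (simp add: scaleR_add_left add_mono)
        moreover have "0 \<le> t1 + t2" using t by simp
        ultimately have "z1 + z2 \<in> A (y1 + y2)"
          using z unfolding A_def by (auto intro: add_mono)
        from upper[OF this] show ?thesis by (simp add: add)
      qed
      have "G y2 \<le> G (y1 + y2) - f z1" if "z1 \<in> A y1" for z1
        by (rule least[OF y(2)]) (use *[OF that] in force)
      then have "G y1 \<le> G (y1 + y2) - G y2"
        by (intro least[OF y(1)]) force
      then show "G y1 + G y2 \<le> G (y1 + y2)" by simp
    qed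
  next
    fix r :: real and y :: 'a assume r: "r > 0" "0 \<le> y"
    have "inverse r * G (r *\<^sub>R y) \<le> G (inverse r *\<^sub>R (r *\<^sub>R y))"
      using r by (intro scale_le) (auto intro: scaleR_nonneg_nonneg)
    then have "G (r *\<^sub>R y) \<le> r * G y" using r by (simp add: field_simps)
    with scale_le[OF r] show "G (r *\<^sub>R y) = r * G y" by (rule antisym[rotated])
  next
    fix y :: 'a assume y: "0 \<le> y"
    have "G y \<le> K * norm y" using f_le by (intro least[OF y]) (auto simp: abs_le_iff)
    then show "\<bar>G y\<bar> \<le> K * norm y" using G_nonneg[OF y] by simp
  qed blast
  show thesis
  proof (rule that[OF g(1)])
    show "0 \<le> g y" if "0 \<le> y" for y using g(2) G_nonneg that by simp
    show "f z \<le> g y" if z: "0 \<le> z" "z \<le> y" "z \<le> t *\<^sub>R x" for y z t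
    proof -
      have "t *\<^sub>R x \<le> \<bar>t\<bar> *\<^sub>R x" using x by (intro scaleR_right_mono) auto
      then have "z \<le> \<bar>t\<bar> *\<^sub>R x" using z(3) by (rule order_trans[rotated])
      then have "z \<in> A y" using z unfolding A_def by (auto intro: exI[of _ "\<bar>t\<bar>"])
      from upper[OF this] show ?thesis using g(2)[of y] z by simp
    qed
    show "\<exists>z t. 0 \<le> z \<and> z \<le> y \<and> 0 \<le> t \<and> z \<le> t *\<^sub>R x \<and> g y < f z + \<epsilon>" if y: "0 \<le> y" "\<epsilon> > 0" for y \<epsilon>
    proof -
      have "G y - \<epsilon> < Sup (f ` A y)" unfolding G_def using y by simp
      then obtain z where "z \<in> A y" "G y - \<epsilon> < f z"
        using less_cSUP_iff[OF _ bdd, of y] A0[OF y(1)] by blast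
      then show ?thesis using g(2)[OF y(1)] by (auto simp: A_def algebra_simps)
    qed
  qed
qed

section \<open>Disjoint sequences\<close>

text \<open>A sum of disjoint positive elements is their supremum, by \<open>add_eq_inf_sup\<close>;
  a partial sum is disjoint from the next term by \<open>inf_add_le\<close>.\<close>

lemma disjoint_sum_le:
  fixes z :: "nat \<Rightarrow> 'a::lattice_ab_group_add"
  assumes nonneg: "\<And>n. n < N \<Longrightarrow> 0 \<le> z n" and le: "\<And>n. n < N \<Longrightarrow> z n \<le> y" and "0 \<le> y"
    and disj: "\<And>m n. m < n \<Longrightarrow> n < N \<Longrightarrow> inf (z m) (z n) = 0"
  shows "(\<Sum>n<N. z n) \<le> y"
  using assms
proof (induction N)
  case (Suc N)
  note prems = Suc.prems and IH = Suc.IH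
  have "inf (\<Sum>n<M. z n) (z N) = 0" if "M \<le> N" for M
    using that
  proof (induction M)
    case 0
    show ?case using prems(1)[of N] by (simp add: inf_absorb1)
  next
    case (Suc M)
    have s: "0 \<le> (\<Sum>n<M. z n)" and zM: "0 \<le> z M" and zN: "0 \<le> z N"
      using prems(1) Suc.prems by (auto intro: sum_nonneg)
    have "inf (\<Sum>n<Suc M. z n) (z N) \<le> inf (\<Sum>n<M. z n) (z N) + inf (z M) (z N)"
      using inf_add_le[OF s zM zN] by simp
    also have "\<dots> = 0" using Suc prems(4)[of M N] by simp
    finally show ?case
      using s zM zN by (intro antisym) (simp_all add: add_nonneg_nonneg)
  qed
  from this[of N] have "(\<Sum>n<N. z n) + z N = sup (\<Sum>n<N. z n) (z N)"
    using add_eq_inf_sup[of "\<Sum>n<N. z n" "z N"] by simp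
  also have "\<dots> \<le> y" using prems IH by simp
  finally show ?case by simp
qed simp

text \<open>g n is the positive part of f carried by x n. For given y the almost optimal z n are
  disjoint and below |y|, so their sum is below |y| and the numbers g n |y| add up to at most C *
  norm y. With f (x n) \<le> |g n (k n)| the claim becomes the Schur statement
  \<open>weakly_compact_l1_null\<close>.\<close>

lemma disjoint_below_weakly_compact_null:
  fixes x :: "nat \<Rightarrow> 'a::banach_lattice" and f :: "'a \<Rightarrow> real"
  assumes K: "weakly_compact K" and k: "\<And>n. k n \<in> K"
    and x: "\<And>n. 0 \<le> x n" "\<And>n. x n \<le> pprt (k n) \<or> x n \<le> pprt (- k n)"
    and disj: "\<And>m n. m \<noteq> n \<Longrightarrow> inf (x m) (x n) = 0"
    and f: "bounded_linear f" and "\<epsilon> > 0"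
  shows "finite {n. \<epsilon> \<le> f (x n)}"
proof -
  interpret bounded_linear f by fact
  obtain C where C: "\<And>x. norm (f x) \<le> norm x * C" "C > 0" using pos_bounded by blast
  have "\<exists>g. bounded_linear g \<and> (\<forall>y. 0 \<le> y \<longrightarrow> 0 \<le> g y) \<and>
    (\<forall>y z t. 0 \<le> z \<longrightarrow> z \<le> y \<longrightarrow> z \<le> t *\<^sub>R x n \<longrightarrow> f z \<le> g y) \<and>
    (\<forall>y. 0 \<le> y \<longrightarrow> (\<forall>\<epsilon>>0. \<exists>z t. 0 \<le> z \<and> z \<le> y \<and> 0 \<le> t \<and> z \<le> t *\<^sub>R x n \<and> g y < f z + \<epsilon>))" for n
    using positive_part_on_principal_ideal[OF f x(1)[of n]] by (smt (verit))
  then obtain g where g: "\<And>n. bounded_linear (g n)" "\<And>n y. 0 \<le> y \<Longrightarrow> 0 \<le> g n y"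
    "\<And>n y z t. 0 \<le> z \<Longrightarrow> z \<le> y \<Longrightarrow> z \<le> t *\<^sub>R x n \<Longrightarrow> f z \<le> g n y"
    "\<And>n y \<epsilon>. 0 \<le> y \<Longrightarrow> \<epsilon> > 0 \<Longrightarrow> \<exists>z t. 0 \<le> z \<and> z \<le> y \<and> 0 \<le> t \<and> z \<le> t *\<^sub>R x n \<and> g n y < f z + \<epsilon>"
    by metis
  have g_diff: "g n (a - b) = g n a - g n b" and g_add: "g n (a + b) = g n a + g n b"
    and g_neg: "g n (- a) = - g n a" for n a b
    using linear_diff linear_add linear_neg bounded_linear.linear[OF g(1)] by blast+
  have g_pprt: "g n a = g n (pprt a) - g n (pprt (- a))" for n a
    by (simp add: pprt_diff_pprt_neg flip: g_diff)
  have g_abs: "\<bar>g n a\<bar> \<le> g n \<bar>a\<bar>" for n a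
    using g_pprt[of n a] g(2)[of "pprt a" n] g(2)[of "pprt (- a)" n]
    by (simp add: abs_eq_pprt_add[of a] g_add)
  \<comment> \<open>An element disjoint from x n is disjoint from all multiples t x n, so only z = 0
    competes in the supremum behind g n.\<close>
  have g_zero: "g n a = 0" if "0 \<le> a" "inf a (x n) = 0" for n a
  proof -
    have "g n a \<le> 0 + \<delta>" if \<delta>: "\<delta> > 0" for \<delta>
    proof -
      obtain z t where z: "0 \<le> z" "z \<le> a" "0 \<le> t" "z \<le> t *\<^sub>R x n" "g n a < f z + \<delta>"
        using g(4)[OF \<open>0 \<le> a\<close> \<delta>, of n] by blast
      have "inf (t *\<^sub>R x n) a = 0"
        using \<open>inf a (x n) = 0\<close> \<open>0 \<le> a\<close> z x(1) by (intro disjoint_scaleR) (simp_all add: inf_commute)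
      then have "z \<le> 0" using z by (metis inf_greatest)
      then have "z = 0" using z by simp
      then show ?thesis using z by (simp add: zero)
    qed
    then have "g n a \<le> 0" by (rule field_le_epsilon)
    then show ?thesis using g(2)[OF \<open>0 \<le> a\<close>, of n] by simp
  qed
  have bound: "(\<Sum>n<N. \<bar>g n y\<bar>) \<le> C * norm y" for y N
  proof -
    have "(\<Sum>n<N. g n \<bar>y\<bar>) \<le> C * norm y + \<delta>" if "\<delta> > 0" for \<delta>
    proof -
      have "\<delta> / (real N + 1) > 0" using that by simp
      then have "\<exists>z t. 0 \<le> z \<and> z \<le> \<bar>y\<bar> \<and> 0 \<le> t \<and> z \<le> t *\<^sub>R x n \<and> g n \<bar>y\<bar> < f z + \<delta> / (real N + 1)" for n
        by (intro g(4)) simp_all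
      then obtain z t where z: "\<And>n. 0 \<le> z n" "\<And>n. z n \<le> \<bar>y\<bar>" "\<And>n. 0 \<le> t n" "\<And>n. z n \<le> t n *\<^sub>R x n"
        "\<And>n. g n \<bar>y\<bar> < f (z n) + \<delta> / (real N + 1)" by metis
      have "(\<Sum>n<N. g n \<bar>y\<bar>) \<le> (\<Sum>n<N. f (z n) + \<delta> / (real N + 1))"
        using z(5) by (intro sum_mono) (simp add: less_imp_le)
      also have "\<dots> = f (\<Sum>n<N. z n) + real N * (\<delta> / (real N + 1))"
        by (simp add: sum.distrib sum)
      also have "\<dots> \<le> f (\<Sum>n<N. z n) + \<delta>" using that by (simp add: field_simps)
      also have "f (\<Sum>n<N. z n) \<le> norm (\<Sum>n<N. z n) * C" using C(1)[of "\<Sum>n<N. z n"] by simp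
      also have "\<dots> \<le> norm \<bar>y\<bar> * C"
      proof (intro mult_right_mono norm_mono_nonneg sum_nonneg disjoint_sum_le)
        fix m n :: nat assume "m < n"
        have "inf (t m *\<^sub>R x m) (x n) = 0"
          using \<open>m < n\<close> disj z x by (intro disjoint_scaleR) auto
        then have "inf (t n *\<^sub>R x n) (t m *\<^sub>R x m) = 0"
          using z x by (intro disjoint_scaleR) (auto simp: inf_commute scaleR_nonneg_nonneg)
        moreover have "inf (z m) (z n) \<le> inf (t n *\<^sub>R x n) (t m *\<^sub>R x m)"
          using z(4) by (simp add: le_infI1 le_infI2)
        ultimately show "inf (z m) (z n) = 0" using z(1) by (intro antisym) simp_all
      qed (use z C in auto)
      finally show ?thesis by (simp add: mult.commute)
    qed
    then have "(\<Sum>n<N. g n \<bar>y\<bar>) \<le> C * norm y" by (rule field_le_epsilon)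
    moreover have "(\<Sum>n<N. \<bar>g n y\<bar>) \<le> (\<Sum>n<N. g n \<bar>y\<bar>)" by (intro sum_mono g_abs)
    ultimately show ?thesis by simp
  qed
  \<comment> \<open>x n lies below one of the parts of k n and is therefore disjoint from the other,
    on which g n vanishes; no cancellation occurs in g n (k n).\<close>
  have large: "f (x n) \<le> \<bar>g n (k n)\<bar>" for n
  proof -
    have *: "f (x n) \<le> g n a" if "x n \<le> pprt a" for a
    proof -
      have "inf (pprt (- a)) (x n) \<le> inf (pprt (- a)) (pprt a)" using that by (rule inf_mono[OF order_refl])
      also have "\<dots> = 0" using inf_pprt_pprt_neg[of a] by (simp add: inf_commute)
      finally have "inf (pprt (- a)) (x n) = 0" using x(1) by (intro antisym) simp_all
      then have "g n (pprt (- a)) = 0" by (intro g_zero) simp_all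
      moreover have "f (x n) \<le> g n (pprt a)" using g(3)[OF x(1) that, of 1] by simp
      ultimately show ?thesis using g_pprt[of n a] by simp
    qed
    from x(2)[of n] show ?thesis
    proof
      assume "x n \<le> pprt (k n)"
      from *[OF this] show ?thesis by simp
    next
      assume "x n \<le> pprt (- k n)"
      from *[OF this] show ?thesis by (simp add: g_neg)
    qed
  qed
  have "finite {n. \<epsilon> \<le> \<bar>g n (k n)\<bar>}"
    using weakly_compact_l1_null[where g = g and k = k and M = C, OF K k g(1) bound \<open>\<epsilon> > 0\<close>] .
  then show ?thesis by (rule rev_finite_subset) (use large order_trans in blast)
qed

section \<open>Generation by a disjoint system\<close>

lemma abs_scaleR_le: "\<bar>r *\<^sub>R x\<bar> \<le> \<bar>r\<bar> *\<^sub>R \<bar>x\<bar>" for x :: "'a::banach_lattice"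
proof (cases "r \<ge> 0")
  case True
  then show ?thesis
    using scaleR_left_mono[OF abs_ge_self, of r x] scaleR_left_mono[OF abs_ge_minus_self, of r x]
    by (intro abs_leI) simp_all
next
  case False
  then have "- r \<ge> 0" by simp
  from scaleR_left_mono[OF abs_ge_self this, of x] scaleR_left_mono[OF abs_ge_minus_self this, of x]
  show ?thesis using False by (intro abs_leI) simp_all
qed

lemma band_disjoint_complement:
  fixes x :: "'a::banach_lattice"
  assumes x: "0 \<le> x"
  shows "band {y. inf \<bar>y\<bar> x = 0}" (is "band ?Z")
proof -
  have le0: "y \<in> ?Z" if "inf \<bar>y\<bar> x \<le> 0" for y using that x by (simp add: antisym)
  have solid: "u \<in> ?Z" if "y \<in> ?Z" "\<bar>u\<bar> \<le> \<bar>y\<bar>" for u y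
  proof (rule le0)
    have "inf \<bar>u\<bar> x \<le> inf \<bar>y\<bar> x" by (intro inf_mono that order_refl)
    then show "inf \<bar>u\<bar> x \<le> 0" using that(1) by (simp only: mem_Collect_eq)
  qed
  have "lattice_ideal ?Z"
    unfolding lattice_ideal_def
  proof (intro conjI)
    show "subspace ?Z"
    proof (rule subspaceI)
      show "0 \<in> ?Z" using x by (simp add: inf_absorb1)
    next
      fix a b assume ab: "a \<in> ?Z" "b \<in> ?Z"
      have "inf \<bar>a + b\<bar> x \<le> inf (\<bar>a\<bar> + \<bar>b\<bar>) x" by (intro inf_mono abs_triangle_ineq order_refl)
      also have "\<dots> \<le> inf \<bar>a\<bar> x + inf \<bar>b\<bar> x" using x by (intro inf_add_le) auto
      also have "\<dots> = 0" using ab by simp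
      finally show "a + b \<in> ?Z" by (rule le0)
    next
      fix r a assume a: "a \<in> ?Z"
      have "inf \<bar>r *\<^sub>R a\<bar> x \<le> inf (\<bar>r\<bar> *\<^sub>R \<bar>a\<bar>) x" by (intro inf_mono abs_scaleR_le order_refl)
      also have "\<dots> = 0" using a x by (intro disjoint_scaleR) auto
      finally show "r *\<^sub>R a \<in> ?Z" by (rule le0)
    qed
    show "closed ?Z"
      unfolding closed_sequential_limits
    proof (intro allI impI, elim conjE)
      fix u and l :: 'a assume u: "\<forall>n. u n \<in> ?Z" "u \<longlonglongrightarrow> l"
      have "(\<lambda>n. \<bar>u n\<bar> - \<bar>l\<bar>) \<longlonglongrightarrow> 0"
      proof (rule Lim_null_comparison[OF always_eventually])
        show "\<forall>n. norm (\<bar>u n\<bar> - \<bar>l\<bar>) \<le> norm (u n - l)" by (intro allI norm_mono abs_triangle_ineq3)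
        show "(\<lambda>n. norm (u n - l)) \<longlonglongrightarrow> 0" using u(2) by (simp add: LIM_zero tendsto_norm_zero)
      qed
      then have "(\<lambda>n. inf \<bar>u n\<bar> x) \<longlonglongrightarrow> inf \<bar>l\<bar> x"
        by (intro tendsto_inf_left) (simp add: LIM_zero_iff)
      moreover have "(\<lambda>n. inf \<bar>u n\<bar> x) = (\<lambda>n. 0)" using u(1) by auto
      ultimately have "(\<lambda>n. 0) \<longlonglongrightarrow> inf \<bar>l\<bar> x" by simp
      then show "l \<in> ?Z" by (simp add: LIMSEQ_const_iff)
    qed
    show "\<forall>u. \<forall>y\<in>?Z. \<bar>u\<bar> \<le> \<bar>y\<bar> \<longrightarrow> u \<in> ?Z" using solid by blast
  qed
  moreover have "s \<in> ?Z" if A: "A \<subseteq> ?Z" and s: "isLub UNIV A s" for A s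
  proof -
    have ub: "a \<le> s" if "a \<in> A" for a
      using s that by (auto simp: isLub_def leastP_def isUb_def setle_def)
    have least: "s \<le> u" if "\<And>a. a \<in> A \<Longrightarrow> a \<le> u" for u
      using s that by (auto simp: isLub_def leastP_def isUb_def setle_def setge_def)
    show ?thesis
    proof (cases "A = {}")
      case True
      \<comment> \<open>A least upper bound of the empty set is a least element of the whole space,
        which forces s = 0.\<close>
      then have "s \<le> 0" "s \<le> s + s" using least by blast+
      then have "s = 0" by simp
      then show ?thesis using x by (simp add: inf_absorb1)
    next
      case False
      then obtain a\<^sub>0 where a0: "a\<^sub>0 \<in> A" by blast
      have neg: "pprt (- s) \<le> pprt (- a)" if "a \<in> A" for a using ub[OF that] by simp
      \<comment> \<open>The part of s^+ that meets x. Every a^+ is disjoint from w, so s - w is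
        still an upper bound of A, and w = 0. The negative part of s is below that of any a in A and
        causes no trouble.\<close>
      define w where "w = inf (pprt s) x"
      have w: "0 \<le> w" using x by (simp add: w_def)
      have "s \<le> s - w"
      proof (rule least)
        fix a assume a: "a \<in> A"
        have "inf (pprt a) x = 0"
        proof (rule antisym)
          have "inf (pprt a) x \<le> inf \<bar>a\<bar> x" by (intro inf_mono pprt_le_abs order_refl)
          also have "\<dots> = 0" using A a by blast
          finally show "inf (pprt a) x \<le> 0" .
        qed (use x in simp)
        moreover have "inf (pprt a) w \<le> inf (pprt a) x" by (simp add: w_def le_infI2)
        ultimately have "inf (pprt a) w = 0" using w by (intro antisym) simp_all
        then have "pprt a + w = sup (pprt a) w"
          using add_eq_inf_sup[of "pprt a" w] by simp
        also have "\<dots> \<le> pprt s" using ub[OF a] by (simp add: w_def)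
        finally have "(pprt a + w) - pprt (- a) \<le> pprt s - pprt (- s)"
          using neg[OF a] by (rule diff_mono)
        moreover have "(pprt a + w) - pprt (- a) = a + w" by (metis diff_add_eq pprt_diff_pprt_neg)
        ultimately have "a + w \<le> s" by (simp only: pprt_diff_pprt_neg)
        then show "a \<le> s - w" by (simp add: algebra_simps)
      qed
      then have "w = 0" using w by simp
      have "inf (pprt (- s)) x \<le> inf (pprt (- a\<^sub>0)) x" by (intro inf_mono neg a0 order_refl)
      also have "\<dots> \<le> inf \<bar>a\<^sub>0\<bar> x" using pprt_le_abs[of "- a\<^sub>0"] by (intro inf_mono) simp_all
      also have "\<dots> = 0" using a0 A by blast
      finally have "inf (pprt (- s)) x \<le> 0" .
      moreover have "inf \<bar>s\<bar> x \<le> inf (pprt s) x + inf (pprt (- s)) x"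
        unfolding abs_eq_pprt_add using x by (intro inf_add_le) auto
      ultimately have "inf \<bar>s\<bar> x \<le> 0"
        using \<open>w = 0\<close> unfolding w_def by (metis add_0 order_trans)
      then show ?thesis by (rule le0)
    qed
  qed
  ultimately show ?thesis unfolding band_def by blast
qed

text \<open>The differences x - w, with w in \<open>I\<close> below x, decrease to 0: a lower bound
  with nonzero positive part would meet some e of E in a nonzero u, and all multiples n u would stay
  in I below x, against the Archimedean property.\<close>

lemma dense_span_order_intervals:
  fixes E :: "'a::banach_lattice set"
  assumes oc: "order_continuous TYPE('a)" and E: "\<And>e. e \<in> E \<Longrightarrow> 0 \<le> e"
    and total: "\<And>z. 0 \<le> z \<Longrightarrow> (\<And>e. e \<in> E \<Longrightarrow> inf z e = 0) \<Longrightarrow> z = 0"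
    and L: "\<And>e. e \<in> E \<Longrightarrow> {0..e} \<subseteq> L"
  shows "closure (span L) = UNIV"
proof -
  \<comment> \<open>The whole interval [0, w] is required to lie in the span, because a linear span
    has no reason to contain suprema: I is closed under sums by Riesz decomposition, and
    \<open>sup u v\<close> enters it as an element below u + v.\<close>
  define I where "I = {w. 0 \<le> w \<and> (\<forall>v. 0 \<le> v \<longrightarrow> v \<le> w \<longrightarrow> v \<in> span L)}"
  have I_add: "w + w' \<in> I" if "w \<in> I" "w' \<in> I" for w w'
    unfolding I_def
  proof (intro CollectI conjI allI impI)
    show "0 \<le> w + w'" using that by (simp add: I_def)
    fix v assume v: "0 \<le> v" "v \<le> w + w'"
    have "0 \<le> w" "0 \<le> w'" using that by (simp_all add: I_def)
    from Riesz_decomposition[OF this v] obtain a b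
      where "v = a + b" "0 \<le> a" "a \<le> w" "0 \<le> b" "b \<le> w'" by blast
    then show "v \<in> span L" using that by (simp add: I_def span_add)
  qed
  have I_down: "v \<in> I" if "w \<in> I" "0 \<le> v" "v \<le> w" for v w
    using that by (auto simp: I_def)
  have I_E: "e \<in> I" if "e \<in> E" for e
    using E[OF that] L[OF that] by (auto simp: I_def intro: span_base)
  have I_0: "0 \<in> I" by (auto simp: I_def span_zero dest: antisym)
  have pos: "x \<in> closure (span L)" if x: "0 \<le> x" for x
    unfolding closure_approachable
  proof (intro allI impI)
    fix \<epsilon> :: real assume "\<epsilon> > 0"
    define D where "D = {x - w | w. w \<in> I \<and> w \<le> x}"
    obtain d where "d \<in> D" "norm d < \<epsilon>"
    proof (rule order_continuousE[OF oc, of D \<epsilon>])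
      show "D \<noteq> {}" using I_0 x by (auto simp: D_def)
    next
      fix a b assume "a \<in> D" "b \<in> D"
      then obtain u v where uv: "a = x - u" "b = x - v" "u \<in> I" "v \<in> I" "u \<le> x" "v \<le> x"
        by (auto simp: D_def)
      have nonneg: "0 \<le> u" "0 \<le> v" using uv by (simp_all add: I_def)
      have "sup u v \<in> I"
        using I_down[OF I_add[OF uv(3,4)]] nonneg by (simp add: sup_le_add le_supI1)
      then have "x - sup u v \<in> D" using uv by (auto simp: D_def)
      then show "\<exists>z\<in>D. z \<le> a \<and> z \<le> b" using uv by (intro bexI[of _ "x - sup u v"]) (auto intro: diff_left_mono)
    next
      fix d assume "d \<in> D" then show "0 \<le> d" by (auto simp: D_def)
    next
      fix z assume z: "\<And>d. d \<in> D \<Longrightarrow> z \<le> d"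
      have z': "pprt z \<le> x - w" if "w \<in> I" "w \<le> x" for w
      proof -
        have "x - w \<in> D" using that by (auto simp: D_def)
        then show ?thesis using z[of "x - w"] that by (simp add: pprt_def)
      qed
      have "inf (pprt z) e = 0" if e: "e \<in> E" for e
      proof -
        define u where "u = inf (pprt z) e"
        have u: "0 \<le> u" "u \<in> I" using E[OF e] by (auto simp: u_def intro: I_down[OF I_E[OF e]])
        have step: "real n *\<^sub>R u \<in> I \<and> real n *\<^sub>R u \<le> x" for n
        proof (induction n)
          case (Suc n)
          have "u \<le> x - real n *\<^sub>R u" using z' Suc by (auto simp: u_def intro: le_infI1)
          then show ?case
            using I_add[OF u(2), of "real n *\<^sub>R u"] Suc by (simp add: algebra_simps)
        qed (use x I_0 in simp)
        then have "u \<le> 0" by (intro archimedean_nonpos[of u x]) blast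
        then have "u = 0" using u(1) by (rule antisym)
        then show ?thesis by (simp add: u_def)
      qed
      then have "pprt z = 0" by (rule total[OF zero_le_pprt])
      then show "z \<le> 0" by (simp add: le_zero_iff_zero_pprt)
    qed (use \<open>\<epsilon> > 0\<close> in auto)
    then obtain w where w: "d = x - w" "w \<in> I" by (auto simp: D_def)
    then have "w \<in> span L" by (simp add: I_def)
    moreover have "dist w x < \<epsilon>" using w \<open>norm d < \<epsilon>\<close> by (simp add: dist_norm norm_minus_commute)
    ultimately show "\<exists>y\<in>span L. dist y x < \<epsilon>" by blast
  qed
  have "x \<in> closure (span L)" for x
  proof -
    obtain u v where "\<And>n. u n \<in> span L" "u \<longlonglongrightarrow> pprt x" "\<And>n. v n \<in> span L" "v \<longlonglongrightarrow> pprt (- x)"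
      using pos[of "pprt x"] pos[of "pprt (- x)"] by (auto simp: closure_sequential)
    then have "\<And>n. u n - v n \<in> span L" "(\<lambda>n. u n - v n) \<longlonglongrightarrow> x"
      using tendsto_diff[of u "pprt x" sequentially v "pprt (- x)"]
      by (simp_all add: span_diff pprt_diff_pprt_neg)
    then show ?thesis
      unfolding closure_sequential by (intro exI[of _ "\<lambda>n. u n - v n"] conjI allI)
  qed
  then show ?thesis by blast
qed

section \<open>The equivalence of the two kinds of generation\<close>

lemma BWCG_imp_WCG:
  assumes oc: "order_continuous TYPE('a::banach_lattice)" and "BWCG TYPE('a)"
  shows "WCG TYPE('a)"
proof -
  obtain K :: "'a set" where K: "weakly_compact K" "band_generated K = UNIV"
    using \<open>BWCG TYPE('a)\<close> by (auto simp: BWCG_def)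
  \<comment> \<open>The bound is by one of the two parts of k, not merely by |k|, as
    \<open>disjoint_below_weakly_compact_null\<close> demands.\<close>
  define S where "S = {x. 0 \<le> x \<and> x \<noteq> 0 \<and> (\<exists>k\<in>K. x \<le> pprt k \<or> x \<le> pprt (- k))}"
  define \<A> where "\<A> = {E. E \<subseteq> S \<and> (\<forall>a\<in>E. \<forall>b\<in>E. a \<noteq> b \<longrightarrow> inf a b = 0)}"
  have "\<exists>E\<in>\<A>. \<forall>E'\<in>\<A>. E \<subseteq> E' \<longrightarrow> E' = E"
  proof (rule subset_Zorn_nonempty)
    have "{} \<in> \<A>" by (simp add: \<A>_def)
    then show "\<A> \<noteq> {}" by blast
    fix \<C> assume \<C>: "\<C> \<noteq> {}" "subset.chain \<A> \<C>"
    show "\<Union>\<C> \<in> \<A>"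
      unfolding \<A>_def
    proof (intro CollectI conjI ballI impI)
      show "\<Union>\<C> \<subseteq> S" using \<C>(2) by (auto simp: subset_chain_def \<A>_def)
      fix a b assume ab: "a \<in> \<Union>\<C>" "b \<in> \<Union>\<C>" "a \<noteq> b"
      then obtain A B where AB: "a \<in> A" "A \<in> \<C>" "b \<in> B" "B \<in> \<C>" by blast
      then have "A \<subseteq> B \<or> B \<subseteq> A" using \<C>(2) by (auto simp: subset_chain_def)
      then obtain D where "D \<in> \<C>" "a \<in> D" "b \<in> D" using AB by blast
      then show "inf a b = 0" using \<C>(2) ab(3) by (auto simp: subset_chain_def \<A>_def)
    qed
  qed
  then obtain E where "E \<in> \<A>" and max: "\<And>E'. E' \<in> \<A> \<Longrightarrow> E \<subseteq> E' \<Longrightarrow> E' = E" by blast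
  then have E: "E \<subseteq> S" "\<And>a b. a \<in> E \<Longrightarrow> b \<in> E \<Longrightarrow> a \<noteq> b \<Longrightarrow> inf a b = 0"
    by (auto simp: \<A>_def)
  have E_nonneg: "0 \<le> e" if "e \<in> E" for e using E(1) that by (auto simp: S_def)
  have total: "z = 0" if z: "0 \<le> z" "\<And>e. e \<in> E \<Longrightarrow> inf z e = 0" for z
  proof (rule ccontr)
    assume "z \<noteq> 0"
    \<comment> \<open>The elements disjoint from z form a band. If it contained K it would be
      everything, and z would be disjoint from itself.\<close>
    have "\<not> K \<subseteq> {y. inf \<bar>y\<bar> z = 0}"
    proof
      assume "K \<subseteq> {y. inf \<bar>y\<bar> z = 0}"
      then have "UNIV \<subseteq> {y. inf \<bar>y\<bar> z = 0}"
        using band_generated_least[OF band_disjoint_complement[OF z(1)]] K(2) by blast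
      then have "inf \<bar>z\<bar> z = 0" by blast
      then show False using z(1) \<open>z \<noteq> 0\<close> by simp
    qed
    then obtain k where k: "k \<in> K" "inf \<bar>k\<bar> z \<noteq> 0" by blast
    have "inf (pprt k) z \<noteq> 0 \<or> inf (pprt (- k)) z \<noteq> 0"
    proof (rule ccontr)
      assume "\<not> ?thesis"
      then have "inf \<bar>k\<bar> z \<le> 0"
        using inf_add_le[of "pprt k" "pprt (- k)" z] z(1) by (simp add: abs_eq_pprt_add)
      moreover have "0 \<le> inf \<bar>k\<bar> z" using z(1) by simp
      ultimately show False using k(2) by simp
    qed
    then obtain k' where k': "k' = k \<or> k' = - k" "inf (pprt k') z \<noteq> 0" by blast
    define w where "w = inf (pprt k') z"
    have "w \<le> pprt k'" "0 \<le> w" "w \<noteq> 0" using k'(2) z(1) by (simp_all add: w_def)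
    then have w: "w \<in> S" unfolding S_def using k(1) k'(1) by blast
    have w_disj: "inf w e = 0" if "e \<in> E" for e
    proof (rule antisym)
      have "inf w e \<le> inf z e" by (simp add: w_def le_infI1 le_infI2)
      then show "inf w e \<le> 0" using z(2)[OF that] by simp
      show "0 \<le> inf w e" using E_nonneg[OF that] z(1) by (simp add: w_def)
    qed
    \<comment> \<open>Maximality puts w into E; being disjoint from every member of E, it is then
      disjoint from itself.\<close>
    then have "insert w E \<in> \<A>" using E w by (auto simp: \<A>_def inf_commute)
    then have "w \<in> E" using max by blast
    then have "w = 0" using w_disj[of w] by simp
    then show False using k'(2) by (simp add: w_def)
  qed
  define L where "L = insert 0 (\<Union>e\<in>E. {0..e})"
  have "weakly_compact L"
    unfolding L_def
  proof (rule weakly_compact_insert_0_UN)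
    show "weakly_compact {0..e}" if "e \<in> E" for e
      using oc E_nonneg[OF that] by (rule weakly_compact_order_interval)
    fix f :: "'a \<Rightarrow> real" and \<epsilon> :: real assume f: "bounded_linear f" and \<epsilon>: "\<epsilon> > 0"
    show "finite {e\<in>E. \<exists>x\<in>{0..e}. \<epsilon> \<le> \<bar>f x\<bar>}" (is "finite ?B")
    proof (rule ccontr)
      assume "infinite ?B"
      \<comment> \<open>Distinct exceptional intervals give a disjoint sequence x n. The null lemma
        limits f (x n) from above only, so it is applied to f and to - f.\<close>
      then obtain e :: "nat \<Rightarrow> 'a" where e: "inj e" "range e \<subseteq> ?B"
        using infinite_countable_subset by blast
      then have "\<exists>x. 0 \<le> x \<and> x \<le> e n \<and> \<epsilon> \<le> \<bar>f x\<bar>" for n by fastforce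
      then obtain x where x: "\<And>n. 0 \<le> x n" "\<And>n. x n \<le> e n" "\<And>n. \<epsilon> \<le> \<bar>f (x n)\<bar>" by metis
      have eE: "e n \<in> E" for n using e(2) by blast
      then have "\<exists>k\<in>K. e n \<le> pprt k \<or> e n \<le> pprt (- k)" for n using E(1) by (auto simp: S_def)
      then obtain k where k: "\<And>n. k n \<in> K" "\<And>n. e n \<le> pprt (k n) \<or> e n \<le> pprt (- k n)" by metis
      have xk: "x n \<le> pprt (k n) \<or> x n \<le> pprt (- k n)" for n
        using k(2)[of n] x(2)[of n] order_trans by blast
      have disj: "inf (x m) (x n) = 0" if "m \<noteq> n" for m n
      proof (rule antisym)
        have "inf (x m) (x n) \<le> inf (e m) (e n)" using x(2) by (intro inf_mono)
        also have "\<dots> = 0" using E(2)[OF eE eE] e(1) that by (simp add: inj_eq)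
        finally show "inf (x m) (x n) \<le> 0" .
      qed (use x(1) in simp)
      have "finite {n. \<epsilon> \<le> f (x n)}" "finite {n. \<epsilon> \<le> - f (x n)}"
        using disjoint_below_weakly_compact_null[where k = k and x = x, OF K(1) k(1) x(1) xk disj f \<epsilon>]
          disjoint_below_weakly_compact_null[where k = k and x = x, OF K(1) k(1) x(1) xk disj bounded_linear_minus[OF f] \<epsilon>] by simp_all
      then have "finite ({n. \<epsilon> \<le> f (x n)} \<union> {n. \<epsilon> \<le> - f (x n)})" by simp
      moreover have "\<epsilon> \<le> f (x n) \<or> \<epsilon> \<le> - f (x n)" for n
        using x(3)[of n] by linarith
      then have "{n. \<epsilon> \<le> f (x n)} \<union> {n. \<epsilon> \<le> - f (x n)} = UNIV" by blast
      ultimately show False by simp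
    qed
  qed
  moreover have "closure (span L) = UNIV"
    using oc E_nonneg total by (rule dense_span_order_intervals) (auto simp: L_def)
  ultimately show ?thesis unfolding WCG_def by blast
qed

theorem theorem3p1:
  assumes "order_continuous TYPE('a::banach_lattice)"
  shows "BWCG TYPE('a) \<longleftrightarrow> WCG TYPE('a)"
proof
  show "WCG TYPE('a)" if "BWCG TYPE('a)" using assms that by (rule BWCG_imp_WCG)
next
  assume "WCG TYPE('a)"
  then obtain K :: "'a set" where K: "weakly_compact K" "closure (span K) = UNIV"
    by (auto simp: WCG_def)
  \<comment> \<open>The same K serves: bands are norm closed subspaces, so the closed span of K lies
    in the band that K generates.\<close>
  have "band (band_generated K)" by (rule band_band_generated)
  then have "subspace (band_generated K)" "closed (band_generated K)"
    by (simp_all add: band_def lattice_ideal_def)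
  then have "closure (span K) \<subseteq> band_generated K"
    by (intro closure_minimal span_minimal subset_band_generated)
  then show "BWCG TYPE('a)" using K unfolding BWCG_def by blast
qed

end
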